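(* There exists a weight function $f:\mathbb{N}\to\{1,3\}$ such that, for the associated depth-weighted random recursive trees $(\mathcal{T}_n)_{n\ge0}$, almost surely, $$\liminf_{n\to\infty}\frac{d(\mathcal{T}_n)}{\log n}\le\frac52\qquad\text{and}\qquad\limsup_{n\to\infty}\frac{d(\mathcal{T}_n)}{\log n}\ge e.$$
   Context: $\mathbb{N}=\{0,1,2,\dots\}$. For a rooted tree, the depth $d(v)$ of a vertex $v$ is its graph distance to the root, and the depth $d(\mathcal{T})$ of a finite rooted tree $\mathcal{T}$ is the maximal depth of its vertices. Given a weight function $f:\mathbb{N}\to(0,\infty)$, the sequence of depth-weighted random recursive trees $(\mathcal{T}_n)_{n\ge0}$ is defined as follows: $\mathcal{T}_0$ consists of a single (root) vertex $v_0$; given $\mathcal{T}_n$, a vertex of $\mathcal{T}_n$ is chosen with probability proportional to its weight, i.e. $v\in\mathcal{T}_n$ is chosen with probability $f(d(v))/\sum_{u\in\mathcal{T}_n}f(d(u))$, and $\mathcal{T}_{n+1}$ is obtained by attaching a new vertex $v_{n+1}$ to the chosen vertex. *)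

theory Defs
  imports "HOL-Probability.Probability"
begin

record rtree =
  verts :: "nat set"
  edges :: "nat set set"
  root :: nat

definition adj :: "rtree \<Rightarrow> (nat \<times> nat) set" where
  "adj T = {(u, v). {u, v} \<in> edges T}"

text \<open>Graph distance: the least length of a walk from \<open>u\<close> to \<open>v\<close> (unspecified if there is none).\<close>

definition graph_dist :: "rtree \<Rightarrow> nat \<Rightarrow> nat \<Rightarrow> nat" where
  "graph_dist T u v = (LEAST k. (u, v) \<in> adj T ^^ k)"

definition vdepth :: "rtree \<Rightarrow> nat \<Rightarrow> nat" where
  "vdepth T v = graph_dist T (root T) v"

definition tree_depth :: "rtree \<Rightarrow> nat" where
  "tree_depth T = Max (vdepth T ` verts T)"

definition singleton_tree :: "nat \<Rightarrow> rtree" where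
  "singleton_tree r = \<lparr>verts = {r}, edges = {}, root = r\<rparr>"

definition attach :: "rtree \<Rightarrow> nat \<Rightarrow> nat \<Rightarrow> rtree" where
  "attach T u w = \<lparr>verts = insert w (verts T), edges = insert {u, w} (edges T), root = root T\<rparr>"

text \<open>
  The vertex \<open>v\<^sub>i\<close> is represented by the number \<open>i\<close>. A sequence \<open>\<omega>\<close> of choices, where
  \<open>\<omega> n\<close> is the vertex of the \<open>n\<close>-th tree that the new vertex \<open>Suc n\<close> is attached to,
  determines the whole sequence of trees.
\<close>

primrec rrt :: "(nat \<Rightarrow> nat) \<Rightarrow> nat \<Rightarrow> rtree" where
  "rrt \<omega> 0 = singleton_tree 0"
| "rrt \<omega> (Suc n) = attach (rrt \<omega> n) (\<omega> n) (Suc n)"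

text \<open>
  The distribution of the chosen vertex. The argument of \<open>embed_pmf\<close> is a probability mass
  function for every positive \<open>f\<close> and every tree with a finite nonempty set of vertices,
  see \<open>pmf_choice_pmf\<close>.
\<close>

definition choice_pmf :: "(nat \<Rightarrow> real) \<Rightarrow> rtree \<Rightarrow> nat pmf" where
  "choice_pmf f T = embed_pmf (\<lambda>v. if v \<in> verts T
     then f (vdepth T v) / (\<Sum>u\<in>verts T. f (vdepth T u)) else 0)"

text \<open>
  The law of the sequence of choices: the measure given by the Ionescu-Tulcea theorem for the
  kernels that choose a vertex of the \<open>n\<close>-th tree given the first \<open>n\<close> choices. Almost sure
  statements about the random trees are statements about \<open>rrt \<omega> n\<close> for almost every
  \<open>\<omega>\<close> with respect to this law. By \<open>prob_space_dwrrt_law\<close> and \<open>dwrrt_law_step\<close> this is a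
  probability measure with the prescribed transition probabilities.
\<close>

definition choice_kernel :: "(nat \<Rightarrow> real) \<Rightarrow> nat \<Rightarrow> (nat \<Rightarrow> nat) \<Rightarrow> nat measure" where
  "choice_kernel f n \<omega> = measure_pmf (choice_pmf f (rrt \<omega> n))"

definition dwrrt_law :: "(nat \<Rightarrow> real) \<Rightarrow> (nat \<Rightarrow> nat) measure" where
  "dwrrt_law f = projective_family.lim UNIV
     (Ionescu_Tulcea.CI (choice_kernel f) (\<lambda>_. count_space UNIV)) (\<lambda>_. count_space UNIV)"

lemma verts_rrt [simp]: "verts (rrt \<omega> n) = {0..n}"
  by (induction n) (auto simp: singleton_tree_def attach_def)

lemma rrt_cong: "(\<And>k. k < n \<Longrightarrow> \<omega> k = \<omega>' k) \<Longrightarrow> rrt \<omega> n = rrt \<omega>' n"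
  by (induction n) auto

lemma pmf_choice_pmf:
  assumes "\<And>n. f n > 0" "finite (verts T)" "verts T \<noteq> {}"
  shows "pmf (choice_pmf f T) v =
    (if v \<in> verts T then f (vdepth T v) / (\<Sum>u\<in>verts T. f (vdepth T u)) else 0)"
proof -
  let ?S = "\<Sum>u\<in>verts T. f (vdepth T u)"
  have pos: "?S > 0" using assms by (intro sum_pos) auto
  have "(\<integral>\<^sup>+v. ennreal (if v \<in> verts T then f (vdepth T v) / ?S else 0) \<partial>count_space UNIV)
      = (\<Sum>v\<in>verts T. ennreal (f (vdepth T v) / ?S))"
    using assms
    by (subst nn_integral_count_space'[where A = "verts T"]) (auto intro!: sum.cong)
  also have "\<dots> = ennreal (\<Sum>v\<in>verts T. f (vdepth T v) / ?S)"
    using assms(1) pos by (intro sum_ennreal divide_nonneg_pos less_imp_le)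
  also have "(\<Sum>v\<in>verts T. f (vdepth T v) / ?S) = 1"
    using pos by (simp flip: sum_divide_distrib)
  finally show ?thesis
    unfolding choice_pmf_def using assms(1) pos
    by (subst pmf_embed_pmf) (auto intro: divide_nonneg_pos less_imp_le)
qed

lemma measurable_finite_prefix:
  assumes "\<And>\<omega> \<omega>' :: nat \<Rightarrow> nat. (\<And>k. k < n \<Longrightarrow> \<omega> k = \<omega>' k) \<Longrightarrow> g \<omega> = g \<omega>'"
    and "\<And>\<omega>. g \<omega> \<in> space N"
  shows "g \<in> measurable (PiM {0..<n} (\<lambda>_. count_space (UNIV :: nat set))) N"
proof -
  let ?P = "PiM {0..<n} (\<lambda>_. count_space (UNIV :: nat set))"
  let ?h = "\<lambda>\<omega>. map \<omega> [0..<n]" and ?r = "\<lambda>xs k. xs ! k"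
  have "?h -` {xs} \<inter> space ?P \<in> sets ?P" for xs
  proof (cases "length xs = n")
    case True
    have "?h \<omega> = xs \<longleftrightarrow> (\<forall>k\<in>{0..<n}. \<omega> k \<in> {xs ! k})" for \<omega>
      unfolding list_eq_iff_nth_eq using True by auto
    then have "?h -` {xs} \<inter> space ?P = PiE {0..<n} (\<lambda>k. {xs ! k})"
      by (simp add: set_eq_iff space_PiM PiE_iff)
    then show ?thesis by (simp add: sets_PiM_I_finite)
  next
    case False
    then have "?h -` {xs} = {}" by auto
    then show ?thesis by simp
  qed
  then have "?h \<in> measurable ?P (count_space UNIV)"
    by (simp add: measurable_count_space_eq2_countable)
  moreover have "(\<lambda>xs. g (?r xs)) \<in> measurable (count_space UNIV) N"
    using assms(2) by auto
  ultimately have "(\<lambda>\<omega>. g (?r (?h \<omega>))) \<in> measurable ?P N"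
    by (rule measurable_compose)
  moreover have "g (?r (?h \<omega>)) = g \<omega>" for \<omega>
    by (rule assms(1)) auto
  ultimately show ?thesis by simp
qed

lemma Ionescu_Tulcea_choice_kernel:
  "Ionescu_Tulcea (choice_kernel f) (\<lambda>_. count_space UNIV)"
proof (rule Ionescu_Tulcea.intro)
  fix n
  show "choice_kernel f n \<in>
      measurable (PiM {0..<n} (\<lambda>_. count_space UNIV)) (subprob_algebra (count_space UNIV))"
  proof (rule measurable_finite_prefix)
    fix \<omega> \<omega>' :: "nat \<Rightarrow> nat" assume "\<And>k. k < n \<Longrightarrow> \<omega> k = \<omega>' k"
    then show "choice_kernel f n \<omega> = choice_kernel f n \<omega>'"
      by (simp add: choice_kernel_def rrt_cong[of n \<omega> \<omega>'])
  next
    show "choice_kernel f n \<omega> \<in> space (subprob_algebra (count_space UNIV))" for \<omega>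
      by (simp add: choice_kernel_def measure_pmf_in_subprob_space)
  qed
next
  fix n and \<omega> :: "nat \<Rightarrow> nat"
  show "prob_space (choice_kernel f n \<omega>)"
    by (simp add: choice_kernel_def prob_space_measure_pmf)
qed

lemma prob_space_dwrrt_law: "prob_space (dwrrt_law f)"
  and space_dwrrt_law [simp]: "space (dwrrt_law f) = UNIV"
  and sets_dwrrt_law: "sets (dwrrt_law f) = sets (PiM UNIV (\<lambda>_. count_space UNIV))"
proof -
  interpret IT: Ionescu_Tulcea "choice_kernel f" "\<lambda>_. count_space UNIV"
    by (rule Ionescu_Tulcea_choice_kernel)
  have eq: "dwrrt_law f = IT.PF.lim"
    by (simp add: dwrrt_law_def)
  show sets: "sets (dwrrt_law f) = sets (PiM UNIV (\<lambda>_. count_space UNIV))"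
    by (simp add: eq)
  show space: "space (dwrrt_law f) = UNIV"
    using sets_eq_imp_space_eq[OF sets] by (simp add: space_PiM)
  have [measurable_cong]: "sets IT.PF.lim = sets (PiM UNIV (\<lambda>_. count_space UNIV))"
    using sets by (simp add: eq)
  have "prob_space (distr IT.PF.lim (PiM {} (\<lambda>_. count_space UNIV)) (\<lambda>x. restrict x {}))"
    by (subst IT.distr_lim) (auto intro!: IT.PF.prob_space_P)
  then show "prob_space (dwrrt_law f)"
    unfolding eq by (rule prob_space_distrD[rotated]) (auto intro!: measurable_restrict)
qed

lemma dwrrt_law_step:
  assumes "\<And>n. f n > 0"
  shows "measure (dwrrt_law f) {\<omega>. \<forall>k<Suc n. \<omega> k = p k} =
    measure (dwrrt_law f) {\<omega>. \<forall>k<n. \<omega> k = p k} *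
    (if p n \<le> n then f (vdepth (rrt p n) (p n)) / (\<Sum>u\<le>n. f (vdepth (rrt p n) u)) else 0)"
proof -
  let ?M = "\<lambda>_::nat. count_space (UNIV :: nat set)"
  interpret IT: Ionescu_Tulcea "choice_kernel f" ?M
    by (rule Ionescu_Tulcea_choice_kernel)
  interpret L: prob_space "dwrrt_law f" by (rule prob_space_dwrrt_law)
  have eq: "dwrrt_law f = IT.PF.lim"
    by (simp add: dwrrt_law_def)
  define B where "B n = PiE {0..<n} (\<lambda>k. {p k})" for n
  have B_sets[measurable]: "B n \<in> sets (PiM {0..<n} ?M)" for n
    unfolding B_def by (simp add: sets_PiM_I_finite)
  have cyl: "emeasure (dwrrt_law f) {\<omega>. \<forall>k<n. \<omega> k = p k} = emeasure (IT.C 0 n (\<lambda>_. undefined)) (B n)"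
    for n
  proof -
    have *: "{\<omega>. \<forall>k<n. \<omega> k = p k} = IT.PF.emb UNIV {0..<n} (B n)"
      by (auto simp: prod_emb_def B_def PiE_iff space_PiM)
    have "prod_emb {0..<n} ?M {0..<n} (B n) = B n"
      by (auto simp: prod_emb_def B_def PiE_iff extensional_def space_PiM restrict_def)
    then show ?thesis
      unfolding * eq by (subst IT.lim) (simp_all add: IT.emeasure_CI[of "{0..<n}" n])
  qed
  let ?C = "IT.C 0 n (\<lambda>_. undefined)"
  have und: "(\<lambda>_. undefined) \<in> space (PiM {0..<0::nat} ?M)"
    by (simp add: space_PiM)
  have spC: "space ?C = space (PiM {0..<n} ?M)"
    using IT.space_C[OF und, of n] by simp
  have setC: "sets ?C = sets (PiM {0..<n} ?M)"
    using IT.sets_C[OF und, of n] by simp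
  let ?q = "pmf (choice_pmf f (rrt p n)) (p n)"
  have "emeasure (IT.C 0 (Suc n) (\<lambda>_. undefined)) (B (Suc n)) =
      (\<integral>\<^sup>+\<omega>. emeasure (IT.eP n \<omega>) (B (Suc n)) \<partial>?C)"
  proof -
    have "IT.eP n \<in> measurable ?C (subprob_algebra (PiM {0..<Suc n} ?M))"
      unfolding measurable_cong_sets[OF setC refl] by (rule IT.measurable_eP)
    moreover have "space ?C \<noteq> {}"
      using prob_space.not_empty[OF IT.prob_space_C[OF und, of n]] .
    ultimately show ?thesis
      using B_sets[of "Suc n"] unfolding IT.C.simps add_0 by (intro emeasure_bind)
  qed
  also have "\<dots> = (\<integral>\<^sup>+\<omega>. ennreal ?q * indicator (B n) \<omega> \<partial>?C)"
  proof (rule nn_integral_cong)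
    fix \<omega> assume "\<omega> \<in> space ?C"
    then have \<omega>: "\<omega> \<in> space (PiM {0..<n} ?M)" by (simp add: spC)
    have 1: "emeasure (IT.eP n \<omega>) (B (Suc n)) =
        emeasure (choice_kernel f n \<omega>) ((\<lambda>x. fun_upd \<omega> n x) -` B (Suc n))"
      using IT.emeasure_eP[OF \<omega> B_sets] by simp
    show "emeasure (IT.eP n \<omega>) (B (Suc n)) = ennreal ?q * indicator (B n) \<omega>"
    proof (cases "\<omega> \<in> B n")
      case True
      then have "(\<lambda>x. fun_upd \<omega> n x) -` B (Suc n) = {p n}"
        by (auto simp: B_def PiE_iff extensional_def atLeast0_lessThan_Suc)
      moreover have "rrt \<omega> n = rrt p n"
        using True by (intro rrt_cong) (auto simp: B_def PiE_iff)
      ultimately show ?thesis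
        using True unfolding 1 by (simp add: choice_kernel_def emeasure_pmf_single)
    next
      case False
      then have "(\<lambda>x. fun_upd \<omega> n x) -` B (Suc n) = {}"
        using \<omega>
        by (auto simp: B_def PiE_iff extensional_def space_PiM atLeast0_lessThan_Suc split: if_splits)
      then show ?thesis using False unfolding 1 by simp
    qed
  qed
  also have "\<dots> = ennreal ?q * emeasure ?C (B n)"
    by (rule nn_integral_cmult_indicator) (simp add: setC)
  finally have "ennreal (measure (dwrrt_law f) {\<omega>. \<forall>k<Suc n. \<omega> k = p k}) =
      ennreal (measure (dwrrt_law f) {\<omega>. \<forall>k<n. \<omega> k = p k} * ?q)"
    unfolding cyl[symmetric] L.emeasure_eq_measure by (simp add: ennreal_mult' mult.commute)
  then have "measure (dwrrt_law f) {\<omega>. \<forall>k<Suc n. \<omega> k = p k} =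
      measure (dwrrt_law f) {\<omega>. \<forall>k<n. \<omega> k = p k} * ?q"
    by (rule iffD1[OF ennreal_inj, rotated 2]) simp_all
  also have "?q = (if p n \<le> n
      then f (vdepth (rrt p n) (p n)) / (\<Sum>u\<le>n. f (vdepth (rrt p n) u)) else 0)"
    using assms by (subst pmf_choice_pmf) (auto simp: atMost_atLeast0)
  finally show ?thesis .
qed

end

theory Submission
  imports Defs "HOL-Real_Asymp.Real_Asymp"
begin

text \<open>
  The weight function alternates between long stretches of depths of weight 3 and of weight 1, each
  chosen after the preceding ones.

  If the weight is 3 on a long stretch from some depth on, a vertex there is chosen at time \<open>t\<close> with
  probability at least \<open>1 / (t + 1)\<close>, as the total weight is at most \<open>3 (t + 1)\<close>. For \<open>c < e\<close> there are
  \<open>k\<close> and \<open>U\<close> with \<open>k > c U\<close> and \<open>U\<^sup>k / k! > 2\<close>, so that with high probability \<open>K\<close> vertices at depth \<open>h\<close>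
  produce \<open>2 K\<close> vertices at depth \<open>h + k\<close> while the logarithm of time grows by \<open>U\<close>. Iterating this
  gives depth at least \<open>c log n\<close>.

  If the weight drops to 1 at depth \<open>L = 2 log n\<close>, most vertices of the tree at times up to \<open>n\<close> are at
  depths of weight 3, so the total weight is almost \<open>3 t\<close>, and a vertex deeper than \<open>L\<close> is chosen with
  probability about \<open>1 / (3 t)\<close> only. A first moment bound then excludes vertices at depth
  \<open>(5 / 2) log n\<close> at time \<open>n\<close>. Both bounds depend on the weights up to a finite depth only, and the
  Borel-Cantelli lemma applies.
\<close>

section \<open>Depths and conditional expectations\<close>

text \<open>Depth as a recursion on the choices, without walks. The \<open>min\<close> makes the
  recursion terminate on every sequence and returns \<open>p k\<close> on valid ones.\<close>

fun dep :: "(nat \<Rightarrow> nat) \<Rightarrow> nat \<Rightarrow> nat" where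
  "dep p 0 = 0"
| "dep p (Suc k) = Suc (dep p (min (p k) k))"

definition valid :: "nat \<Rightarrow> (nat \<Rightarrow> nat) \<Rightarrow> bool" where
  "valid n p \<longleftrightarrow> (\<forall>k<n. p k \<le> k)"

lemma dep_cong: "(\<And>k. k < v \<Longrightarrow> p k = q k) \<Longrightarrow> dep p v = dep q v"
proof (induction p v rule: dep.induct)
  case (2 p k)
  have "dep p (min (p k) k) = dep q (min (p k) k)"
    by (rule "2.IH") (use "2.prems" in auto)
  then show ?case using "2.prems"[of k] by simp
qed simp

lemma dep_le: "dep p v \<le> v"
  by (induction p v rule: dep.induct) (auto intro: le_trans)

lemma dep_upd [simp]: "v \<le> n \<Longrightarrow> dep (p(n := w)) v = dep p v"
  by (rule dep_cong) auto

lemma dep_upd_Suc [simp]: "w \<le> n \<Longrightarrow> dep (p(n := w)) (Suc n) = Suc (dep p w)"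
  by simp

lemma root_rrt: "root (rrt p n) = 0"
  by (induction n) (auto simp: singleton_tree_def attach_def)

lemma edges_rrt: "edges (rrt p n) = (\<lambda>k. {p k, Suc k}) ` {..<n}"
  by (induction n) (auto simp: singleton_tree_def attach_def lessThan_Suc)

lemma adj_rrt: "(u, v) \<in> adj (rrt p n) \<longleftrightarrow>
    (\<exists>k<n. (u = p k \<and> v = Suc k) \<or> (v = p k \<and> u = Suc k))"
  by (auto simp: adj_def edges_rrt doubleton_eq_iff image_iff)

text \<open>Following parents gives a walk of length \<open>dep p v\<close> from the root.
  Conversely, \<open>dep\<close> increases by at most 1 along an edge, so no walk is
  shorter.\<close>

lemma vdepth_rrt:
  assumes "valid n p" "v \<le> n"
  shows "vdepth (rrt p n) v = dep p v"
proof -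
  have walk: "(0, v) \<in> adj (rrt p n) ^^ dep p v" if "v \<le> n" for v
    using that
  proof (induction v rule: less_induct)
    case (less v)
    show ?case
    proof (cases v)
      case (Suc k)
      then have pk: "p k \<le> k" "k < n" using less.prems assms(1) by (auto simp: valid_def)
      then have "(0, p k) \<in> adj (rrt p n) ^^ dep p (p k)"
        using less Suc by auto
      moreover have "(p k, Suc k) \<in> adj (rrt p n)"
        using pk by (auto simp: adj_rrt)
      ultimately show ?thesis using Suc pk by (auto simp: min_absorb1)
    qed simp
  qed
  have lip: "dep p v \<le> k" if "(0, v) \<in> adj (rrt p n) ^^ k" for k v
    using that
  proof (induction k arbitrary: v)
    case (Suc k)
    then obtain u where u: "(0, u) \<in> adj (rrt p n) ^^ k" "(u, v) \<in> adj (rrt p n)" by auto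
    then have "dep p u \<le> k" using Suc.IH by simp
    moreover have "dep p v \<le> Suc (dep p u)"
      using u(2) assms(1) by (auto simp: adj_rrt valid_def min_absorb1)
    ultimately show ?case by simp
  qed simp
  show ?thesis
    unfolding vdepth_def graph_dist_def root_rrt
    using walk[OF assms(2)] lip by (intro Least_equality) auto
qed

lemma tree_depth_rrt:
  assumes "valid n p"
  shows "tree_depth (rrt p n) = Max (dep p ` {..n})"
proof -
  have "vdepth (rrt p n) ` verts (rrt p n) = dep p ` {..n}"
    using assms by (intro image_cong) (auto simp: vdepth_rrt)
  then show ?thesis by (simp add: tree_depth_def)
qed

section \<open>Conditional expectations over finitely many further choices\<close>

definition dsum :: "(nat \<Rightarrow> real) \<Rightarrow> nat \<Rightarrow> (nat \<Rightarrow> nat) \<Rightarrow> real" where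
  "dsum g n p = (\<Sum>v\<le>n. g (dep p v))"

lemma dsum_upd: "v \<le> n \<Longrightarrow> dsum g (Suc n) (p(n := v)) = dsum g n p + g (Suc (dep p v))"
  by (simp add: dsum_def del: dep.simps)

text \<open>The one-step transition operator, written as a finite sum so that the estimates on it
  are elementary; \<open>dsum f n p\<close> is the total weight of the \<open>n\<close>-th
  tree.\<close>

definition step :: "(nat \<Rightarrow> real) \<Rightarrow> nat \<Rightarrow> ((nat \<Rightarrow> nat) \<Rightarrow> real) \<Rightarrow> (nat \<Rightarrow> nat) \<Rightarrow> real" where
  "step f n F p = (\<Sum>v\<le>n. f (dep p v) / dsum f n p * F (p(n := v)))"

text \<open>The conditional expectation of \<open>F\<close>, a function of the first \<open>n + j\<close> choices, given that the
  first \<open>n\<close> choices are those of \<open>p\<close>.\<close>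

primrec cexp :: "(nat \<Rightarrow> real) \<Rightarrow> nat \<Rightarrow> nat \<Rightarrow> ((nat \<Rightarrow> nat) \<Rightarrow> real) \<Rightarrow> (nat \<Rightarrow> nat) \<Rightarrow> real" where
  "cexp f n 0 F p = F p"
| "cexp f n (Suc j) F p = step f n (cexp f (Suc n) j F) p"

definition wf13 :: "(nat \<Rightarrow> real) \<Rightarrow> bool" where
  "wf13 f \<longleftrightarrow> (\<forall>k. f k \<in> {1, 3})"

lemma wf13_ge: "wf13 f \<Longrightarrow> f k \<ge> 1"
  and wf13_pos: "wf13 f \<Longrightarrow> f k > 0"
  and wf13_le: "wf13 f \<Longrightarrow> f k \<le> 3"
  by (auto simp: wf13_def elim!: allE[of _ k])

lemma dsum_wf13_ge: "wf13 f \<Longrightarrow> dsum f n p \<ge> real n + 1"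
  using sum_mono[of "{..n}" "\<lambda>_. 1" "\<lambda>v. f (dep p v)"] by (auto simp: dsum_def wf13_ge)

lemma dsum_wf13_le: "wf13 f \<Longrightarrow> dsum f n p \<le> 3 * (real n + 1)"
  using sum_mono[of "{..n}" "\<lambda>v. f (dep p v)" "\<lambda>_. 3"] by (auto simp: dsum_def wf13_le)

lemma dsum_wf13_pos: "wf13 f \<Longrightarrow> dsum f n p > 0"
  using dsum_wf13_ge[of f n p] by simp

lemma sum_step_weights: "wf13 f \<Longrightarrow> (\<Sum>v\<le>n. f (dep p v) / dsum f n p) = 1"
  using dsum_wf13_pos[of f n p] by (simp flip: sum_divide_distrib add: dsum_def)

lemma step_mono:
  assumes "wf13 f" "\<And>v. v \<le> n \<Longrightarrow> F (p(n := v)) \<le> G (p(n := v))"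
  shows "step f n F p \<le> step f n G p"
  unfolding step_def
  using assms dsum_wf13_pos[of f n p] wf13_pos[of f]
  by (intro sum_mono mult_left_mono) (auto intro!: divide_nonneg_pos less_imp_le)

lemma step_affine:
  assumes "wf13 f"
  shows "step f n (\<lambda>q. a + b * F q) p = a + b * step f n F p"
proof -
  have "step f n (\<lambda>q. a + b * F q) p = (\<Sum>v\<le>n. f (dep p v) / dsum f n p) * a + b * step f n F p"
    unfolding step_def sum_distrib_left sum_distrib_right sum.distrib[symmetric]
    by (intro sum.cong) (auto simp: field_simps add_divide_distrib)
  then show ?thesis using assms by (simp add: sum_step_weights)
qed

lemma step_const: "wf13 f \<Longrightarrow> step f n (\<lambda>q. a) p = a"
  using step_affine[of f n a 0 "\<lambda>_. 0" p] by simp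

lemma step_sum: "step f n (\<lambda>q. \<Sum>i\<in>A. F i q) p = (\<Sum>i\<in>A. step f n (F i) p)"
  unfolding step_def by (subst sum.swap) (simp add: sum_distrib_left)

lemma cexp_sum: "cexp f n j (\<lambda>q. \<Sum>i\<in>A. F i q) p = (\<Sum>i\<in>A. cexp f n j (F i) p)"
proof (induction j arbitrary: n p)
  case (Suc j)
  have "cexp f (Suc n) j (\<lambda>q. \<Sum>i\<in>A. F i q) = (\<lambda>q. \<Sum>i\<in>A. cexp f (Suc n) j (F i) q)"
    by (rule ext) (rule Suc.IH)
  then show ?case by (simp add: step_sum)
qed simp

text \<open>The predicate \<open>I\<close> is an invariant of the process, so the two functions need
  to be compared only where it holds at the final time.\<close>

lemma cexp_mono:
  assumes "wf13 f" "I n p"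
    and "\<And>i p v. I i p \<Longrightarrow> v \<le> i \<Longrightarrow> I (Suc i) (p(i := v))"
    and "\<And>q. I (n + j) q \<Longrightarrow> F q \<le> G q"
  shows "cexp f n j F p \<le> cexp f n j G p"
  using assms(2,4)
proof (induction j arbitrary: n p)
  case (Suc j)
  show ?case unfolding cexp.simps
    by (intro step_mono assms(1) Suc.IH assms(3)) (use Suc.prems in auto)
qed simp

lemma cexp_affine:
  assumes "wf13 f"
  shows "cexp f n j (\<lambda>q. a + b * F q) p = a + b * cexp f n j F p"
proof (induction j arbitrary: n p)
  case (Suc j)
  have "cexp f (Suc n) j (\<lambda>q. a + b * F q) = (\<lambda>q. a + b * cexp f (Suc n) j F q)"
    by (rule ext) (rule Suc.IH)
  then show ?case using assms by (simp add: step_affine)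
qed simp

lemma cexp_tower: "cexp f n (i + j) F p = cexp f n i (cexp f (n + i) j F) p"
proof (induction i arbitrary: n p)
  case (Suc i)
  have "cexp f (Suc n) (i + j) F = cexp f (Suc n) i (cexp f (Suc n + i) j F)"
    by (rule ext) (rule Suc.IH)
  then show ?case by simp
qed simp

text \<open>The one-step inequality is iterated backwards from the final time, and it is required
  only under the invariant.\<close>

lemma cexp_supermartingale:
  assumes "wf13 f" "I n p"
    and "\<And>i p v. I i p \<Longrightarrow> v \<le> i \<Longrightarrow> I (Suc i) (p(i := v))"
    and "\<And>i p. n \<le> i \<Longrightarrow> i < n + j \<Longrightarrow> I i p \<Longrightarrow> step f i (G (Suc i)) p \<le> G i p"
  shows "cexp f n j (G (n + j)) p \<le> G n p"
  using assms(2,4)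
proof (induction j arbitrary: n p)
  case (Suc j)
  have "cexp f n (Suc j) (G (n + Suc j)) p \<le> step f n (G (Suc n)) p"
    unfolding cexp.simps
  proof (rule step_mono[OF assms(1)])
    fix v assume "v \<le> n"
    then show "cexp f (Suc n) j (G (n + Suc j)) (p(n := v)) \<le> G (Suc n) (p(n := v))"
      using Suc.IH[of "Suc n" "p(n := v)"] Suc.prems assms(3) by (simp del: fun_upd_apply)
  qed
  also have "\<dots> \<le> G n p" using Suc.prems by simp
  finally show ?case .
qed simp

text \<open>The probability that \<open>Q\<close> fails at time \<open>m\<close>, given the choices up to time \<open>n\<close>.\<close>

definition fail :: "(nat \<Rightarrow> real) \<Rightarrow> nat \<Rightarrow> nat \<Rightarrow> ((nat \<Rightarrow> nat) \<Rightarrow> bool) \<Rightarrow> (nat \<Rightarrow> nat) \<Rightarrow> real" where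
  "fail f n m Q p = cexp f n (m - n) (\<lambda>q. of_bool (\<not> Q q)) p"

lemma cexp_le_const:
  assumes "wf13 f" "I n p"
    and "\<And>i p v. I i p \<Longrightarrow> v \<le> i \<Longrightarrow> I (Suc i) (p(i := v))"
    and "\<And>q. I (n + j) q \<Longrightarrow> F q \<le> c"
  shows "cexp f n j F p \<le> c"
  using cexp_mono[of f I n p j F "\<lambda>_. c"] cexp_affine[of f n j c 0 "\<lambda>_. 0" p] assms by simp

text \<open>Condition on the choices up to time \<open>m\<close>: either \<open>Q\<close> fails
  there, with probability at most \<open>a\<close>, or the remaining failure probability is at most
  \<open>b\<close>. Local estimates are concatenated in this way.\<close>

lemma fail_chain:
  assumes "wf13 f" "n \<le> m" "m \<le> r" "I n p"
    and inv: "\<And>i p v. I i p \<Longrightarrow> v \<le> i \<Longrightarrow> I (Suc i) (p(i := v))"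
    and 1: "fail f n m Q p \<le> a"
    and 2: "\<And>q. I m q \<Longrightarrow> Q q \<Longrightarrow> fail f m r R q \<le> b" and "b \<ge> 0"
  shows "fail f n r R p \<le> a + b"
proof -
  have le1: "fail f m r R q \<le> 1" for q
    unfolding fail_def by (rule cexp_le_const[OF assms(1), of "\<lambda>_ _. True"]) auto
  have "fail f n r R p = cexp f n (m - n) (fail f m r R) p"
    using cexp_tower[of f n "m - n" "r - m" _ p] assms(2,3) by (simp add: fail_def[abs_def])
  also have "\<dots> \<le> cexp f n (m - n) (\<lambda>q. b + 1 * of_bool (\<not> Q q)) p"
    using assms(2) le1 \<open>b \<ge> 0\<close>
    by (intro cexp_mono[OF assms(1), of I] assms(4) inv) (auto intro: 2 add_increasing)
  also have "\<dots> = b + fail f n m Q p"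
    unfolding fail_def by (subst cexp_affine[OF assms(1)]) simp
  finally show ?thesis using 1 by simp
qed

section \<open>Vertex counts and the law of the choices\<close>

definition cnt :: "nat \<Rightarrow> nat \<Rightarrow> (nat \<Rightarrow> nat) \<Rightarrow> real" where
  "cnt j = dsum (\<lambda>k. of_bool (k = j))"

lemma cnt_nonneg: "cnt j n p \<ge> 0"
  by (simp add: cnt_def dsum_def sum_nonneg)

lemma cnt_upd: "v \<le> n \<Longrightarrow> cnt j (Suc n) (p(n := v)) = cnt j n p + of_bool (Suc (dep p v) = j)"
  by (simp add: cnt_def dsum_upd del: fun_upd_apply)

lemma cnt_upd_ge: "v \<le> n \<Longrightarrow> cnt j (Suc n) (p(n := v)) \<ge> cnt j n p"
  by (simp add: cnt_upd)

lemma valid_upd: "valid n p \<Longrightarrow> v \<le> n \<Longrightarrow> valid (Suc n) (p(n := v))"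
  by (auto simp: valid_def less_Suc_eq)

lemma weight_cnt:
  "(\<Sum>v\<le>n. f (dep p v) / dsum f n p * of_bool (dep p v = j)) = f j * cnt j n p / dsum f n p"
  unfolding cnt_def dsum_def[of "\<lambda>k. of_bool (k = j)"] sum_distrib_left sum_divide_distrib
  by (intro sum.cong) auto

text \<open>A Chernoff bound. With at least \<open>a\<close> vertices at depth \<open>j\<close>, one
  of them is chosen at time \<open>t\<close> with probability at least
  \<open>f j * a / (3 * (t + 1))\<close>, so in logarithmic time vertices at depth
  \<open>j + 1\<close> appear at rate at least \<open>f j * a / 3\<close>.\<close>

lemma fail_cnt_Suc:
  assumes f: "wf13 f" and "n \<le> m" "s \<ge> 0" "a \<ge> 0"
    and "cnt j n p \<ge> a" and "cnt (Suc j) n p \<ge> c"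
    and \<delta>: "\<delta> \<le> ln ((real m + 1) / (real n + 1))"
  shows "fail f n m (\<lambda>q. cnt (Suc j) m q \<ge> c + b) p
    \<le> exp (s * b - (1 - exp (- s)) * (f j / 3 * a * \<delta>))"
proof -
  define \<kappa> where "\<kappa> = (1 - exp (- s)) * (f j / 3 * a)"
  have fj: "f j > 0" using f by (rule wf13_pos)
  have k0: "\<kappa> \<ge> 0" unfolding \<kappa>_def using assms fj by (intro mult_nonneg_nonneg) auto
  \<comment> \<open>The exponential supermartingale. At time \<open>m\<close> the logarithm
    vanishes, and \<open>G\<close> is then at least 1 whenever the required count is missed.\<close>
  define G where "G t q = exp (s * (c + b - cnt (Suc j) t q)
      - \<kappa> * ln ((real m + 1) / (real t + 1)))" for t q
  have "fail f n m (\<lambda>q. cnt (Suc j) m q \<ge> c + b) p \<le> cexp f n (m - n) (G (n + (m - n))) p"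
    unfolding fail_def
    using assms by (intro cexp_mono[OF f, of "\<lambda>_ _. True"]) (auto simp: G_def)
  also have "\<dots> \<le> G n p"
  proof (rule cexp_supermartingale[OF f, of "\<lambda>t q. a \<le> cnt j t q"])
    fix t q assume t: "n \<le> t" "t < n + (m - n)" and a: "a \<le> cnt j t q"
    define \<pi> where "\<pi> = f j * cnt j t q / dsum f t q"
    define B where "B = exp (s * (c + b - cnt (Suc j) t q) - \<kappa> * ln ((real m + 1) / (real (Suc t) + 1)))"
    have "step f t (G (Suc t)) q = (\<Sum>v\<le>t. f (dep q v) / dsum f t q *
        (B * (1 - (1 - exp (- s)) * of_bool (dep q v = j))))"
      unfolding step_def
    proof (intro sum.cong arg_cong2[where f = "(*)"] refl)
      fix v assume v: "v \<in> {..t}"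
      show "G (Suc t) (q(t := v)) = B * (1 - (1 - exp (- s)) * of_bool (dep q v = j))"
        using v by (auto simp: G_def cnt_upd B_def algebra_simps simp flip: exp_add simp del: fun_upd_apply)
    qed
    also have "\<dots> = B * ((\<Sum>v\<le>t. f (dep q v) / dsum f t q) - (1 - exp (- s)) *
        (\<Sum>v\<le>t. f (dep q v) / dsum f t q * of_bool (dep q v = j)))"
      unfolding sum_distrib_left sum_subtractf[symmetric]
      by (intro sum.cong refl) (simp add: right_diff_distrib mult.left_commute)
    also have "\<dots> = B * (1 - (1 - exp (- s)) * \<pi>)"
      by (simp only: sum_step_weights[OF f] weight_cnt \<pi>_def)
    also have "\<dots> \<le> B * exp (- \<kappa> * ln ((real (Suc t) + 1) / (real t + 1)))"
    proof (rule mult_left_mono)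
      have "ln ((real (Suc t) + 1) / (real t + 1)) \<le> 1 / (real t + 1)"
        by (rule order.trans[OF ln_le_minus_one]) (auto simp: field_simps)
      then have "\<kappa> * ln ((real (Suc t) + 1) / (real t + 1)) \<le> \<kappa> * (1 / (real t + 1))"
        by (intro mult_left_mono k0)
      also have "\<dots> = (1 - exp (- s)) * (f j * a / (3 * (real t + 1)))"
        by (simp add: \<kappa>_def field_simps)
      also have "\<dots> \<le> (1 - exp (- s)) * \<pi>"
        unfolding \<pi>_def
        using a fj assms dsum_wf13_le[OF f, of t q] dsum_wf13_pos[OF f, of t q]
        by (intro mult_left_mono frac_le) auto
      finally have "1 - (1 - exp (- s)) * \<pi> \<le> 1 + (- \<kappa> * ln ((real (Suc t) + 1) / (real t + 1)))"
        by simp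
      also have "\<dots> \<le> exp (- \<kappa> * ln ((real (Suc t) + 1) / (real t + 1)))"
        by (rule exp_ge_add_one_self)
      finally show "1 - (1 - exp (- s)) * \<pi> \<le> \<dots>" .
    qed (simp add: B_def)
    also have "\<dots> = G t q"
      by (simp add: B_def G_def ln_div algebra_simps flip: exp_add)
    finally show "step f t (G (Suc t)) q \<le> G t q" .
  next
    show "a \<le> cnt j (Suc i) (p(i := v))" if "a \<le> cnt j i p" "v \<le> i" for i p v
      using that cnt_upd_ge[of v i j p] by linarith
  qed fact
  also have "G n p \<le> exp (s * b - \<kappa> * \<delta>)"
  proof -
    have "\<kappa> * \<delta> \<le> \<kappa> * ln ((real m + 1) / (real n + 1))"
      using \<delta> k0 by (rule mult_left_mono)
    moreover have "s * (c + b - cnt (Suc j) n p) \<le> s * b"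
      using assms by (intro mult_left_mono) auto
    ultimately show ?thesis unfolding G_def by simp
  qed
  finally show ?thesis by (simp add: \<kappa>_def algebra_simps)
qed

section \<open>Events of finite horizon under the law of the choices\<close>

lemma sets_dwrrt_law_prefix:
  assumes "\<And>\<omega> \<omega>'. (\<And>k. k < n \<Longrightarrow> \<omega> k = \<omega>' k) \<Longrightarrow> Q \<omega> = Q \<omega>'"
  shows "{\<omega>. Q \<omega>} \<in> sets (dwrrt_law f)"
proof -
  have *: "Q (restrict \<omega> {0..<n}) = Q \<omega>" for \<omega> :: "nat \<Rightarrow> nat"
    by (rule assms) simp
  have "(\<lambda>\<omega>. Q (restrict \<omega> {0..<n})) \<in>
      measurable (PiM UNIV (\<lambda>_. count_space UNIV)) (count_space UNIV)"
  proof (rule measurable_compose[where g = Q])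
    show "(\<lambda>\<omega>. restrict \<omega> {0..<n}) \<in> measurable (PiM UNIV (\<lambda>_. count_space UNIV))
        (PiM {0..<n} (\<lambda>_. count_space (UNIV :: nat set)))"
      by (rule measurable_restrict_subset) simp
    show "Q \<in> measurable (PiM {0..<n} (\<lambda>_. count_space UNIV)) (count_space UNIV)"
      by (rule measurable_finite_prefix, rule assms, blast) simp
  qed
  then have "{\<omega> \<in> space (PiM UNIV (\<lambda>_. count_space UNIV)). Q \<omega>} \<in> sets (PiM UNIV (\<lambda>_. count_space UNIV))"
    unfolding * by (simp add: pred_def)
  then show ?thesis by (simp add: sets_dwrrt_law space_PiM)
qed

lemma measure_cylinder_Suc:
  assumes "wf13 f" "valid n p" "v \<le> n"
  shows "measure (dwrrt_law f) {\<omega>. \<forall>k<Suc n. \<omega> k = (p(n := v)) k} =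
    measure (dwrrt_law f) {\<omega>. \<forall>k<n. \<omega> k = p k} * (f (dep p v) / dsum f n p)"
proof -
  have r: "rrt (p(n := v)) n = rrt p n" by (rule rrt_cong) simp
  have c: "{\<omega>. \<forall>k<n. \<omega> k = (p(n := v)) k} = {\<omega>. \<forall>k<n. \<omega> k = p k}" by auto
  have s: "(\<Sum>u\<le>n. f (vdepth (rrt p n) u)) = dsum f n p"
    unfolding dsum_def using assms by (intro sum.cong) (auto simp: vdepth_rrt)
  show ?thesis
    using dwrrt_law_step[of f n "p(n := v)", OF wf13_pos[OF assms(1)]] assms
    by (simp only: r c s fun_upd_same if_True vdepth_rrt)
qed

text \<open>Ties \<open>cexp\<close> to \<open>dwrrt_law\<close> as the conditional probability
  given a cylinder. The induction splits the cylinder by the next choice.\<close>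

lemma measure_cylinder_cexp:
  assumes f: "wf13 f" and "valid n p"
    and Q: "\<And>\<omega> \<omega>'. (\<And>k. k < n + j \<Longrightarrow> \<omega> k = \<omega>' k) \<Longrightarrow> Q \<omega> = Q \<omega>'"
  shows "measure (dwrrt_law f) {\<omega>. (\<forall>k<n. \<omega> k = p k) \<and> Q \<omega>} =
    measure (dwrrt_law f) {\<omega>. \<forall>k<n. \<omega> k = p k} * cexp f n j (\<lambda>q. of_bool (Q q)) p"
  using assms(2) Q
proof (induction j arbitrary: n p)
  case 0
  have *: "Q \<omega> = Q p" if "\<forall>k<n. \<omega> k = p k" for \<omega>
    using that by (intro 0(2)) simp
  show ?case
  proof (cases "Q p")
    case True
    then have "{\<omega>. (\<forall>k<n. \<omega> k = p k) \<and> Q \<omega>} = {\<omega>. \<forall>k<n. \<omega> k = p k}" using * by blast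
    then show ?thesis using True by simp
  next
    case False
    then have "{\<omega>. (\<forall>k<n. \<omega> k = p k) \<and> Q \<omega>} = {}" using * by blast
    then show ?thesis using False by (simp only: of_bool_def if_False) simp
  qed
next
  case (Suc j)
  interpret L: prob_space "dwrrt_law f" by (rule prob_space_dwrrt_law)
  let ?C = "{\<omega>. \<forall>k<n. \<omega> k = p k}"
  let ?D = "\<lambda>v. {\<omega>. \<forall>k<Suc n. \<omega> k = (p(n := v)) k}"
  have D: "?D v = ?C \<inter> {\<omega>. \<omega> n = v}" for v
    by (auto simp: less_Suc_eq)
  have meas: "?C \<in> L.events" "?D v \<in> L.events" for v
    by (rule sets_dwrrt_law_prefix[of n]; simp) (rule sets_dwrrt_law_prefix[of "Suc n"]; simp)
  have meas_Un: "(\<Union>v\<in>{..n}. ?D v) \<in> L.events" by (intro sets.finite_UN meas(2)) simp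
  have Un_sub: "(\<Union>v\<in>{..n}. ?D v) \<subseteq> ?C" unfolding D by blast
  have measQ: "{\<omega>. Q \<omega>} \<in> L.events"
    by (rule sets_dwrrt_law_prefix) (rule Suc.prems(2))
  have measDQ: "?D v \<inter> {\<omega>. Q \<omega>} \<in> L.events" for v by (intro sets.Int meas(2) measQ)
  \<comment> \<open>The one-step weights sum to 1, so the choices \<open>v \<le> n\<close> exhaust
    the cylinder up to a null set.\<close>
  have "L.prob (\<Union>v\<in>{..n}. ?D v) = (\<Sum>v\<le>n. L.prob (?D v))"
  proof (rule L.finite_measure_finite_Union)
    show "?D ` {..n} \<subseteq> L.events" using meas(2) by blast
    show "disjoint_family_on ?D {..n}" unfolding D by (auto simp: disjoint_family_on_def)
  qed simp
  also have "\<dots> = (\<Sum>v\<le>n. L.prob ?C * (f (dep p v) / dsum f n p))"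
    using measure_cylinder_Suc[OF f Suc.prems(1)] by (intro sum.cong) auto
  also have "\<dots> = L.prob ?C"
    unfolding sum_distrib_left[symmetric] sum_step_weights[OF f] by simp
  finally have "L.prob (?C - (\<Union>v\<in>{..n}. ?D v)) = 0"
    by (subst L.finite_measure_Diff[OF meas(1) meas_Un Un_sub]) simp
  then have null: "?C - (\<Union>v\<in>{..n}. ?D v) \<in> null_sets (dwrrt_law f)"
    by (intro null_setsI sets.Diff[OF meas(1) meas_Un])
       (simp only: L.emeasure_eq_measure ennreal_0)
  have "L.prob {\<omega>. (\<forall>k<n. \<omega> k = p k) \<and> Q \<omega>} = L.prob (\<Union>v\<in>{..n}. ?D v \<inter> {\<omega>. Q \<omega>})"
  proof (rule measure_eq_AE)
    have "AE \<omega> in dwrrt_law f. \<omega> \<notin> ?C - (\<Union>v\<in>{..n}. ?D v)"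
      using null by (rule AE_not_in)
    then show "AE \<omega> in dwrrt_law f. \<omega> \<in> {\<omega>. (\<forall>k<n. \<omega> k = p k) \<and> Q \<omega>} \<longleftrightarrow>
        \<omega> \<in> (\<Union>v\<in>{..n}. ?D v \<inter> {\<omega>. Q \<omega>})"
      by eventually_elim (auto simp: D)
    have "?C \<inter> {\<omega>. Q \<omega>} \<in> L.events" by (intro sets.Int meas(1) measQ)
    then show "{\<omega>. (\<forall>k<n. \<omega> k = p k) \<and> Q \<omega>} \<in> L.events" by (simp add: Int_def)
    show "(\<Union>v\<in>{..n}. ?D v \<inter> {\<omega>. Q \<omega>}) \<in> L.events"
      by (intro sets.finite_UN measDQ) simp
  qed
  also have "\<dots> = (\<Sum>v\<le>n. L.prob (?D v \<inter> {\<omega>. Q \<omega>}))"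
  proof (rule L.finite_measure_finite_Union)
    show "(\<lambda>v. ?D v \<inter> {\<omega>. Q \<omega>}) ` {..n} \<subseteq> L.events" using measDQ by blast
    show "disjoint_family_on (\<lambda>v. ?D v \<inter> {\<omega>. Q \<omega>}) {..n}"
      unfolding D by (auto simp: disjoint_family_on_def)
  qed simp
  also have "\<dots> = (\<Sum>v\<le>n. L.prob ?C *
      (f (dep p v) / dsum f n p * cexp f (Suc n) j (\<lambda>q. of_bool (Q q)) (p(n := v))))"
  proof (intro sum.cong refl)
    fix v assume "v \<in> {..n}"
    then have v: "v \<le> n" by simp
    have "L.prob (?D v \<inter> {\<omega>. Q \<omega>}) = L.prob (?D v) * cexp f (Suc n) j (\<lambda>q. of_bool (Q q)) (p(n := v))"
      unfolding Int_def mem_Collect_eq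
    proof (rule Suc.IH[OF valid_upd[OF Suc.prems(1) v]])
      show "Q a = Q b" if "\<And>k. k < Suc n + j \<Longrightarrow> a k = b k" for a b
        using that by (intro Suc.prems(2)) simp
    qed
    then show "L.prob (?D v \<inter> {\<omega>. Q \<omega>}) = L.prob ?C *
      (f (dep p v) / dsum f n p * cexp f (Suc n) j (\<lambda>q. of_bool (Q q)) (p(n := v)))"
      by (simp only: measure_cylinder_Suc[OF f Suc.prems(1) v] mult.assoc)
  qed
  also have "\<dots> = L.prob ?C * cexp f n (Suc j) (\<lambda>q. of_bool (Q q)) p"
    by (simp only: step_def cexp.simps sum_distrib_left)
  finally show ?case .
qed

text \<open>For the empty prefix the cylinder is the whole space; the sequence of zeros supplies a
  valid starting point.\<close>

lemma measure_dwrrt_law_fail: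
  assumes f: "wf13 f" and Q: "\<And>\<omega> \<omega>'. (\<And>k. k < n \<Longrightarrow> \<omega> k = \<omega>' k) \<Longrightarrow> Q \<omega> = Q \<omega>'"
  shows "measure (dwrrt_law f) {\<omega>. \<not> Q \<omega>} = fail f 0 n Q (\<lambda>_. 0)"
proof -
  interpret L: prob_space "dwrrt_law f" by (rule prob_space_dwrrt_law)
  have "measure (dwrrt_law f) {\<omega>. (\<forall>k<0. \<omega> k = 0) \<and> \<not> Q \<omega>} =
    measure (dwrrt_law f) {\<omega>. \<forall>k<0. \<omega> k = 0} * cexp f 0 n (\<lambda>q. of_bool (\<not> Q q)) (\<lambda>_. 0)"
  proof (rule measure_cylinder_cexp[OF f])
    show "(\<not> Q \<omega>) = (\<not> Q \<omega>')" if "\<And>k. k < 0 + n \<Longrightarrow> \<omega> k = \<omega>' k" for \<omega> \<omega>'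
      using Q[of \<omega> \<omega>'] that by simp
  qed (simp add: valid_def)
  then show ?thesis using L.prob_space by (simp add: fail_def)
qed

section \<open>Parameters of the cascade\<close>

text \<open>A bound of Stirling type. The induction step is
  \<open>(1 + 1 / k) ^ (k + 1) \<ge> exp 1\<close>.\<close>

lemma fact_le_power: "k \<ge> 1 \<Longrightarrow> fact k * exp (real k - 1) \<le> real k ^ Suc k"
proof (induction k rule: nat_induct_at_least)
  case (Suc k)
  have "1 / (real k + 1) \<le> ln ((real k + 1) / real k)"
  proof -
    have "ln (real k / (real k + 1)) \<le> real k / (real k + 1) - 1"
      using Suc by (intro ln_le_minus_one) auto
    then show ?thesis using Suc by (simp add: ln_div field_simps)
  qed
  then have "real (Suc k) * (1 / (real k + 1)) \<le> real (Suc k) * ln ((real k + 1) / real k)"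
    by (intro mult_left_mono) auto
  then have "1 \<le> real (Suc k) * ln ((real k + 1) / real k)" by (simp add: add.commute)
  then have "exp 1 \<le> exp (real (Suc k) * ln ((real k + 1) / real k))" by simp
  also have "\<dots> = ((real k + 1) / real k) ^ Suc k"
    using Suc by (subst exp_of_nat_mult) simp
  finally have e: "exp 1 * real k ^ Suc k \<le> (real k + 1) ^ Suc k"
    using Suc by (simp add: power_divide field_simps)
  have "fact (Suc k) * exp (real (Suc k) - 1) = (real k + 1) * exp 1 * (fact k * exp (real k - 1))"
    by (simp add: exp_diff field_simps)
  also have "\<dots> \<le> (real k + 1) * exp 1 * real k ^ Suc k"
    using Suc by (intro mult_left_mono) auto
  also have "\<dots> \<le> (real k + 1) * (real k + 1) ^ Suc k"
    using e by (simp only: mult.assoc) (intro mult_left_mono; simp)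
  finally show ?case by (simp add: add.commute)
qed simp

text \<open>By \<open>fact_le_power\<close> the quotient is at least
  \<open>(exp 1 / c) ^ k / (exp 1 * k)\<close>, which grows exponentially since
  \<open>c < exp 1\<close>.\<close>

lemma eventually_power_div_fact_gt:
  assumes "0 < c" "c < exp 1"
  shows "eventually (\<lambda>k. (real k / c) ^ k / fact k > 2) sequentially"
proof -
  define r where "r = exp 1 / c"
  have r: "r > 1" using assms by (simp add: r_def)
  have "filterlim (\<lambda>k. r ^ k / real k) at_top sequentially"
    using r by real_asymp
  then have "eventually (\<lambda>k. r ^ k / real k > 2 * exp 1) sequentially"
    by (simp add: filterlim_at_top_dense)
  then show ?thesis
    using eventually_ge_at_top[of 1]
  proof eventually_elim
    case (elim k)
    have "fact k * exp (real k - 1) \<le> real k * real k ^ k"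
      using fact_le_power[of k] elim by simp
    then have "exp (real k - 1) / real k \<le> real k ^ k / fact k"
      using elim by (simp add: field_simps)
    then have "(exp (real k - 1) / real k) / c ^ k \<le> (real k ^ k / fact k) / c ^ k"
      using assms by (intro divide_right_mono) auto
    moreover have "(exp (real k - 1) / real k) / c ^ k = r ^ k / real k / exp 1"
      by (simp add: r_def exp_diff power_divide flip: exp_of_nat_mult)
    moreover have "r ^ k / real k / exp 1 > 2"
      using elim by (simp add: field_simps)
    ultimately show ?case by (simp add: power_divide field_simps)
  qed
qed

lemma choose_div_power_tendsto: "(\<lambda>M. real (M choose k) / real M ^ k) \<longlonglongrightarrow> 1 / fact k"
proof -
  have "(\<lambda>M. (\<Prod>i<k. (real M - real i) / real M) / fact k) \<longlonglongrightarrow> (\<Prod>i<k. 1) / fact k"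
    by (intro tendsto_intros tendsto_prod) (real_asymp, simp)
  moreover have "real (M choose k) / real M ^ k = (\<Prod>i<k. (real M - real i) / real M) / fact k" for M
    by (simp add: binomial_gbinomial gbinomial_prod_rev prod_dividef lessThan_atLeast0)
  ultimately show ?thesis by simp
qed

text \<open>\<open>M\<close> Euler steps of size \<open>\<beta>\<close> turn \<open>K\<close>
  vertices into \<open>(M choose k) * \<beta> ^ k * K\<close> vertices \<open>k\<close> levels
  deeper; for fixed \<open>U = M * \<beta>\<close> this factor tends to
  \<open>U ^ k / fact k\<close> as \<open>M\<close> grows. Each step lasts \<open>\<delta>\<close>
  in logarithmic time, and the gap between \<open>\<beta>\<close> and \<open>\<delta>\<close> pays
  for the deviation bound.\<close>

lemma cascade_parameters:
  assumes "0 < c" "c < exp 1"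
  obtains k M :: nat and \<beta> \<delta> :: real where "M \<ge> 1" "0 < \<beta>" "\<beta> \<le> 1" "\<beta> < \<delta>"
    "real (M choose k) * \<beta> ^ k \<ge> 2" "real k > c * real M * \<delta>"
proof -
  \<comment> \<open>Two rates between \<open>c\<close> and \<open>exp 1\<close>:
    \<open>M * \<beta> = k / c2\<close> gives the factor 2 because \<open>c2 < exp 1\<close>,
    \<open>M * \<delta> = k / c1\<close> gives \<open>k > c * M * \<delta>\<close> because
    \<open>c < c1\<close>, and \<open>c1 < c2\<close> gives
    \<open>\<beta> < \<delta>\<close>.\<close>
  define c1 where "c1 = c + (exp 1 - c) / 3"
  define c2 where "c2 = c + 2 * (exp 1 - c) / 3"
  have c: "c < c1" "c1 < c2" "c2 < exp 1" using assms by (simp_all add: c1_def c2_def field_simps)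
  obtain k where k: "k \<ge> 1" "(real k / c2) ^ k / fact k > 2"
    using eventually_conj[OF eventually_ge_at_top[of 1] eventually_power_div_fact_gt[of c2]] c assms
    by (auto simp: eventually_sequentially)
  have "(\<lambda>M. (real k / c2) ^ k * (real (M choose k) / real M ^ k)) \<longlonglongrightarrow> (real k / c2) ^ k * (1 / fact k)"
    by (intro tendsto_mult tendsto_const choose_div_power_tendsto)
  then have "eventually (\<lambda>M. (real k / c2) ^ k * (real (M choose k) / real M ^ k) > 2) sequentially"
    using k by (intro order_tendstoD) auto
  moreover have "eventually (\<lambda>M. real k / c2 \<le> real M) sequentially"
    using filterlim_real_sequentially by (simp add: filterlim_at_top)
  moreover have "eventually (\<lambda>M. M \<ge> 1) sequentially" by (rule eventually_ge_at_top)
  ultimately have "eventually (\<lambda>M. M \<ge> 1 \<and> real k / c2 \<le> real M \<and>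
      (real k / c2) ^ k * (real (M choose k) / real M ^ k) > 2) sequentially"
    by eventually_elim auto
  then obtain M where M: "M \<ge> 1" "real k / c2 \<le> real M"
      "(real k / c2) ^ k * (real (M choose k) / real M ^ k) > 2"
    by (auto simp: eventually_sequentially)
  define \<beta> where "\<beta> = real k / (c2 * real M)"
  define \<delta> where "\<delta> = real k / (c1 * real M)"
  show ?thesis
  proof (rule that[of M \<beta> \<delta> k])
    show "M \<ge> 1" by fact
    show "0 < \<beta>" "\<beta> \<le> 1" using k M c assms by (auto simp: \<beta>_def field_simps)
    show "\<beta> < \<delta>" using k M c assms by (auto simp: \<beta>_def \<delta>_def field_simps)
    have "real (M choose k) * \<beta> ^ k = (real k / c2) ^ k * (real (M choose k) / real M ^ k)"
      by (simp add: \<beta>_def power_divide power_mult_distrib)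
    then show "2 \<le> real (M choose k) * \<beta> ^ k" using M by simp
    show "c * real M * \<delta> < real k" using k M c assms by (auto simp: \<delta>_def field_simps)
  qed
qed

text \<open>A step of length at least \<open>\<delta>\<close> in logarithmic time, rounded up to an
  integer time.\<close>

definition grid :: "real \<Rightarrow> nat \<Rightarrow> nat" where
  "grid \<delta> n = nat \<lceil>exp \<delta> * (real n + 1)\<rceil>"

lemma grid:
  assumes "\<delta> > 0"
  shows grid_gt: "grid \<delta> n > n" and grid_le: "real (grid \<delta> n) \<le> exp \<delta> * (real n + 1) + 1"
    and grid_ln: "\<delta> \<le> ln ((real (grid \<delta> n) + 1) / (real n + 1))"
proof -
  have ge: "real (grid \<delta> n) \<ge> exp \<delta> * (real n + 1)"
    unfolding grid_def by linarith
  have "exp \<delta> * (real n + 1) \<ge> 1 * (real n + 1)"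
    using assms by (intro mult_right_mono) auto
  then have "1 * (real n + 1) \<le> real (grid \<delta> n)" using ge by (rule order.trans)
  then show "grid \<delta> n > n" by simp
  show "real (grid \<delta> n) \<le> exp \<delta> * (real n + 1) + 1"
    unfolding grid_def using ceiling_correct[of "exp \<delta> * (real n + 1)"] by (auto simp: of_nat_nat)
  have "exp \<delta> \<le> (real (grid \<delta> n) + 1) / (real n + 1)"
    using ge by (simp add: field_simps)
  then show "\<delta> \<le> ln ((real (grid \<delta> n) + 1) / (real n + 1))"
    by (metis add_pos_nonneg divide_pos_pos ln_exp ln_le_cancel_iff exp_gt_zero of_nat_0_le_iff zero_less_one add.commute)
qed

lemma grid_pow_ge: "\<delta> > 0 \<Longrightarrow> (grid \<delta> ^^ i) n \<ge> n + i"
proof (induction i)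
  case (Suc i)
  then show ?case using grid_gt[of \<delta> "(grid \<delta> ^^ i) n"] by simp
qed simp

text \<open>The rounding of the grid costs only a bounded amount on the logarithmic scale, however
  many steps are made.\<close>

lemma ln_grid_pow_le:
  assumes "\<delta> > 0"
  obtains C where "\<And>i. ln (real ((grid \<delta> ^^ i) n) + 1) \<le> \<delta> * real i + C"
proof
  \<comment> \<open>Shifting by \<open>b\<close> turns the affine recursion
    \<open>x \<mapsto> exp \<delta> * (x + 1) + 1\<close> into multiplication by
    \<open>exp \<delta>\<close>.\<close>
  define b where "b = (exp \<delta> + 1) / (exp \<delta> - 1)"
  have e: "exp \<delta> > 1" using assms by simp
  have b: "b \<ge> 1" "exp \<delta> + 1 + b = exp \<delta> * b" using e by (auto simp: b_def field_simps)
  fix i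
  have "real ((grid \<delta> ^^ i) n) + b \<le> exp (\<delta> * real i) * (real n + b)"
  proof (induction i)
    case (Suc i)
    have "real ((grid \<delta> ^^ Suc i) n) + b \<le> exp \<delta> * (real ((grid \<delta> ^^ i) n) + 1) + 1 + b"
      using grid_le[OF assms] by simp
    also have "\<dots> = exp \<delta> * (real ((grid \<delta> ^^ i) n) + b)"
      using b by (simp add: algebra_simps)
    also have "\<dots> \<le> exp \<delta> * (exp (\<delta> * real i) * (real n + b))"
      using Suc by (intro mult_left_mono) auto
    finally show ?case by (simp add: algebra_simps exp_add)
  qed simp
  then have "ln (real ((grid \<delta> ^^ i) n) + 1) \<le> ln (exp (\<delta> * real i) * (real n + b))"
    using b by (subst ln_le_cancel_iff) auto
  also have "\<dots> = \<delta> * real i + ln (real n + b)"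
    using b by (subst ln_mult) auto
  finally show "ln (real ((grid \<delta> ^^ i) n) + 1) \<le> \<delta> * real i + ln (real n + b)" .
qed

section \<open>Trees of large height\<close>

lemma fail_mono:
  assumes "wf13 f" "n \<le> m" "valid n p" "\<And>q. valid m q \<Longrightarrow> Q q \<Longrightarrow> R q"
  shows "fail f n m R p \<le> fail f n m Q p"
  unfolding fail_def using assms by (intro cexp_mono[of f valid] valid_upd) auto

text \<open>The deviation bound as a property of three numbers: one \<open>\<kappa>\<close> serves
  all weight functions, depths, times and counts, so parameters can be fixed before the weight is
  known.\<close>

definition growth_rate :: "real \<Rightarrow> real \<Rightarrow> real \<Rightarrow> bool" where
  "growth_rate \<beta> \<delta> \<kappa> \<longleftrightarrow> \<kappa> > 0 \<and> (\<forall>f h n p a c.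
    wf13 f \<longrightarrow> f h = 3 \<longrightarrow> a \<ge> 0 \<longrightarrow> cnt h n p \<ge> a \<longrightarrow> cnt (Suc h) n p \<ge> c \<longrightarrow>
    fail f n (grid \<delta> n) (\<lambda>q. cnt (Suc h) (grid \<delta> n) q \<ge> c + \<beta> * a) p \<le> exp (- (\<kappa> * a)))"

lemma growth_rate_pos: "growth_rate \<beta> \<delta> \<kappa> \<Longrightarrow> \<kappa> > 0"
  by (simp add: growth_rate_def)

lemma growth_rateD:
  "\<lbrakk>growth_rate \<beta> \<delta> \<kappa>; wf13 f; f h = 3; a \<ge> 0; cnt h n p \<ge> a; cnt (Suc h) n p \<ge> c\<rbrakk> \<Longrightarrow>
    fail f n (grid \<delta> n) (\<lambda>q. cnt (Suc h) (grid \<delta> n) q \<ge> c + \<beta> * a) p \<le> exp (- (\<kappa> * a))"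
  unfolding growth_rate_def by blast

lemma growth_rate_exists:
  assumes "0 < \<beta>" "\<beta> < \<delta>"
  shows "\<exists>\<kappa>. growth_rate \<beta> \<delta> \<kappa>"
proof -
  \<comment> \<open>With this \<open>s\<close>, \<open>\<beta> * (1 + s)\<close> is the midpoint of
    \<open>\<beta>\<close> and \<open>\<delta>\<close>; then
    \<open>1 - exp (- s) \<ge> s / (1 + s)\<close> makes the Chernoff exponent
    \<open>\<kappa>\<close> positive.\<close>
  define s where "s = (\<delta> / \<beta> - 1) / 2"
  have s: "s > 0" "\<beta> * (1 + s) < \<delta>" using assms by (auto simp: s_def field_simps)
  define \<kappa> where "\<kappa> = (1 - exp (- s)) * \<delta> - s * \<beta>"
  have "s / (1 + s) \<le> 1 - exp (- s)"
    using exp_ge_add_one_self[of s] s by (simp add: exp_minus field_simps)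
  then have "s / (1 + s) * \<delta> \<le> (1 - exp (- s)) * \<delta>"
    using assms by (intro mult_right_mono) auto
  moreover have "s * \<beta> < s / (1 + s) * \<delta>"
    using s mult_strict_left_mono[OF s(2) s(1)] by (simp add: field_simps)
  ultimately have "\<kappa> > 0" by (simp add: \<kappa>_def)
  moreover have "fail f n (grid \<delta> n) (\<lambda>q. cnt (Suc h) (grid \<delta> n) q \<ge> c + \<beta> * a) p \<le> exp (- (\<kappa> * a))"
    if *: "wf13 f" "f h = 3" "a \<ge> 0" "cnt h n p \<ge> a" "cnt (Suc h) n p \<ge> c" for f h n p a c
  proof -
  have "fail f n (grid \<delta> n) (\<lambda>q. cnt (Suc h) (grid \<delta> n) q \<ge> c + \<beta> * a) p
      \<le> exp (s * (\<beta> * a) - (1 - exp (- s)) * (f h / 3 * a * \<delta>))"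
    using * assms s grid_gt[of \<delta> n] grid_ln[of \<delta> n] by (intro fail_cnt_Suc) auto
  also have "s * (\<beta> * a) - (1 - exp (- s)) * (f h / 3 * a * \<delta>) = - (\<kappa> * a)"
    using * by (simp add: \<kappa>_def algebra_simps)
  finally show ?thesis .
  qed
  ultimately show ?thesis unfolding growth_rate_def by blast
qed

text \<open>The Euler scheme for \<open>y\<^sub>j' = y\<^sub>j\<^sub>-\<^sub>1\<close> with step \<open>\<beta>\<close> and \<open>y\<^sub>0 = K\<close>, where \<open>y\<^sub>j\<close> is the number of vertices
  at depth \<open>h + j\<close> in logarithmic time.\<close>

definition envelope :: "real \<Rightarrow> real \<Rightarrow> nat \<Rightarrow> nat \<Rightarrow> nat \<Rightarrow> nat \<Rightarrow> (nat \<Rightarrow> nat) \<Rightarrow> bool" where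
  "envelope K \<beta> h k i n q \<longleftrightarrow> (\<forall>j\<le>k. cnt (h + j) n q \<ge> K * \<beta> ^ j * real (i choose j))"

text \<open>By Pascal's rule the next bound at level \<open>j + 1\<close> is the present one plus
  \<open>\<beta>\<close> times the present bound at level \<open>j\<close>, an increase that
  \<open>growth_rate\<close> supplies. Level 0 persists because counts never decrease; a union bound
  covers the other \<open>k\<close> levels.\<close>

lemma fail_envelope_Suc:
  assumes f: "wf13 f" "\<And>j. j < k \<Longrightarrow> f (h + j) = 3"
    and \<beta>: "0 < \<beta>" "\<beta> \<le> 1" "0 < \<delta>" and K: "K \<ge> 0" and \<kappa>: "growth_rate \<beta> \<delta> \<kappa>"
    and E: "envelope K \<beta> h k i n p"
  shows "fail f n (grid \<delta> n) (envelope K \<beta> h k (Suc i) (grid \<delta> n)) p \<le> real k * exp (- (\<kappa> * (K * \<beta> ^ k)))"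
proof -
  let ?m = "grid \<delta> n"
  have nm: "n < ?m" using \<beta> by (intro grid_gt)
  define a where "a j = K * \<beta> ^ j * real (i choose j)" for j
  have th: "K * \<beta> ^ Suc j * real (Suc i choose Suc j) = a (Suc j) + \<beta> * a j" for j
    by (simp add: a_def algebra_simps)
  have a: "cnt (h + j) n p \<ge> a j" if "j \<le> k" for j
    using E that by (simp add: envelope_def a_def)
  have "fail f n ?m (envelope K \<beta> h k (Suc i) ?m) p
      \<le> cexp f n (?m - n) (\<lambda>q. \<Sum>j<k. of_bool (\<not> cnt (Suc (h + j)) ?m q \<ge> a (Suc j) + \<beta> * a j)) p"
    unfolding fail_def
  proof (rule cexp_mono[OF f(1), of "\<lambda>t q. K \<le> cnt h t q"])
    show "K \<le> cnt h n p" using a[of 0] by (simp add: a_def)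
    show "K \<le> cnt h (Suc i) (p(i := v))" if "K \<le> cnt h i p" "v \<le> i" for i p v
      using that cnt_upd_ge[of v i h p] by linarith
    fix q assume "K \<le> cnt h (n + (?m - n)) q"
    then have q: "K \<le> cnt h ?m q" using nm by simp
    show "of_bool (\<not> envelope K \<beta> h k (Suc i) ?m q)
      \<le> (\<Sum>j<k. of_bool (\<not> cnt (Suc (h + j)) ?m q \<ge> a (Suc j) + \<beta> * a j) :: real)"
    proof (cases "envelope K \<beta> h k (Suc i) ?m q")
      case False
      then obtain j where j: "j \<le> k" "\<not> cnt (h + j) ?m q \<ge> K * \<beta> ^ j * real (Suc i choose j)"
        by (auto simp: envelope_def)
      then obtain j' where j': "j = Suc j'" using q by (cases j) auto
      then have "\<not> cnt (Suc (h + j')) ?m q \<ge> a (Suc j') + \<beta> * a j'"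
        using j(2) unfolding j' th by simp
      then have "1 = (of_bool (\<not> cnt (Suc (h + j')) ?m q \<ge> a (Suc j') + \<beta> * a j') :: real)" by simp
      also have "\<dots> \<le> (\<Sum>j<k. of_bool (\<not> cnt (Suc (h + j)) ?m q \<ge> a (Suc j) + \<beta> * a j) :: real)"
        using j j' by (intro member_le_sum) auto
      finally show ?thesis by simp
    qed (simp add: sum_nonneg)
  qed
  also have "\<dots> = (\<Sum>j<k. fail f n ?m (\<lambda>q. cnt (Suc (h + j)) ?m q \<ge> a (Suc j) + \<beta> * a j) p)"
    by (simp only: cexp_sum fail_def)
  also have "\<dots> \<le> (\<Sum>j<k. exp (- (\<kappa> * (K * \<beta> ^ k))))"
  proof (rule sum_mono)
    fix j assume "j \<in> {..<k}"
    then have j: "j < k" by simp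
    show "fail f n ?m (\<lambda>q. cnt (Suc (h + j)) ?m q \<ge> a (Suc j) + \<beta> * a j) p \<le> exp (- (\<kappa> * (K * \<beta> ^ k)))"
    \<comment> \<open>For \<open>i < j\<close> the threshold is 0. Otherwise
      \<open>a j \<ge> K * \<beta> ^ k\<close> since \<open>\<beta> \<le> 1\<close>, so the error
      bound is uniform in \<open>j\<close>.\<close>
    proof (cases "i < j")
      case True
      then have "a (Suc j) + \<beta> * a j = 0" by (simp add: a_def binomial_eq_0)
      then have "cnt (Suc (h + j)) ?m q \<ge> a (Suc j) + \<beta> * a j" for q
        using cnt_nonneg by simp
      then show ?thesis unfolding fail_def
        by (intro cexp_le_const[OF f(1), of "\<lambda>_ _. True"]) auto
    next
      case False
      then have "(i choose j) \<ge> 1" by (simp add: Suc_le_eq zero_less_binomial)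
      then have "1 \<le> real (i choose j)" by simp
      then have "K * \<beta> ^ k * 1 \<le> K * \<beta> ^ j * real (i choose j)"
        using K \<beta> j by (intro mult_mono mult_left_mono power_decreasing) auto
      then have "exp (- (\<kappa> * a j)) \<le> exp (- (\<kappa> * (K * \<beta> ^ k)))"
        using growth_rate_pos[OF \<kappa>] by (simp add: a_def)
      moreover have "fail f n ?m (\<lambda>q. cnt (Suc (h + j)) ?m q \<ge> a (Suc j) + \<beta> * a j) p \<le> exp (- (\<kappa> * a j))"
        using a[of j] a[of "Suc j"] j f K \<beta> by (intro growth_rateD[OF \<kappa>]) (auto simp: a_def)
      ultimately show ?thesis by linarith
    qed
  qed
  finally show ?thesis by simp
qed

text \<open>The envelope is followed over \<open>M\<close> grid steps and ends at level
  \<open>k\<close> with at least \<open>2 * K\<close>. The exponential error is weakened to order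
  \<open>1 / K\<close>, which is geometrically summable over successive doublings.\<close>

lemma fail_double:
  assumes f: "wf13 f" "\<And>j. j < k \<Longrightarrow> f (h + j) = 3"
    and \<beta>: "0 < \<beta>" "\<beta> \<le> 1" "0 < \<delta>" and K: "K > 0" and \<kappa>: "growth_rate \<beta> \<delta> \<kappa>"
    and M: "real (M choose k) * \<beta> ^ k \<ge> 2"
    and "cnt h n p \<ge> K" "valid n p"
  shows "fail f n ((grid \<delta> ^^ M) n) (\<lambda>q. cnt (h + k) ((grid \<delta> ^^ M) n) q \<ge> 2 * K) p
    \<le> real M * real k / (\<kappa> * \<beta> ^ k * K)"
proof -
  let ?b = "real k * exp (- (\<kappa> * (K * \<beta> ^ k)))"
  have "fail f n ((grid \<delta> ^^ i) n) (envelope K \<beta> h k i ((grid \<delta> ^^ i) n)) p \<le> real i * ?b" for i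
  proof (induction i)
    case 0
    have "envelope K \<beta> h k 0 n p"
      unfolding envelope_def
    proof safe
      fix j show "K * \<beta> ^ j * real (0 choose j) \<le> cnt (h + j) n p"
        using assms cnt_nonneg by (cases j) auto
    qed
    then show ?case by (simp add: fail_def)
  next
    case (Suc i)
    have "fail f n (grid \<delta> ((grid \<delta> ^^ i) n)) (envelope K \<beta> h k (Suc i) (grid \<delta> ((grid \<delta> ^^ i) n))) p
        \<le> real i * ?b + ?b"
    proof (rule fail_chain[OF f(1), where I = "\<lambda>_ _. True", OF _ _ _ _ Suc])
      show "n \<le> (grid \<delta> ^^ i) n" using grid_pow_ge[OF \<beta>(3), of n i] by simp
      show "(grid \<delta> ^^ i) n \<le> grid \<delta> ((grid \<delta> ^^ i) n)" using grid_gt[OF \<beta>(3)] less_imp_le by blast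
      show "fail f ((grid \<delta> ^^ i) n) (grid \<delta> ((grid \<delta> ^^ i) n))
            (envelope K \<beta> h k (Suc i) (grid \<delta> ((grid \<delta> ^^ i) n))) q \<le> ?b"
        if "envelope K \<beta> h k i ((grid \<delta> ^^ i) n) q" for q
        by (rule fail_envelope_Suc[OF f \<beta> less_imp_le[OF K] \<kappa> that])
    qed auto
    then show ?case by (simp add: algebra_simps)
  qed
  from this[of M] have "fail f n ((grid \<delta> ^^ M) n) (envelope K \<beta> h k M ((grid \<delta> ^^ M) n)) p
      \<le> real M * ?b" .
  moreover have "fail f n ((grid \<delta> ^^ M) n) (\<lambda>q. cnt (h + k) ((grid \<delta> ^^ M) n) q \<ge> 2 * K) p
      \<le> fail f n ((grid \<delta> ^^ M) n) (envelope K \<beta> h k M ((grid \<delta> ^^ M) n)) p"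
  proof (rule fail_mono[OF f(1)])
    fix q assume "envelope K \<beta> h k M ((grid \<delta> ^^ M) n) q"
    then have "K * \<beta> ^ k * real (M choose k) \<le> cnt (h + k) ((grid \<delta> ^^ M) n) q"
      by (simp add: envelope_def)
    moreover have "K * 2 \<le> K * (real (M choose k) * \<beta> ^ k)"
      using M K by (intro mult_left_mono) auto
    ultimately show "2 * K \<le> cnt (h + k) ((grid \<delta> ^^ M) n) q" by (simp add: mult.commute mult.left_commute)
  qed (use assms grid_pow_ge[OF \<beta>(3), of n M] in auto)
  moreover have "real M * ?b \<le> real M * real k / (\<kappa> * \<beta> ^ k * K)"
  proof -
    define x where "x = \<kappa> * (K * \<beta> ^ k)"
    have x: "x > 0" using K \<beta> growth_rate_pos[OF \<kappa>] by (simp add: x_def)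
    have "x \<le> exp x" using exp_ge_add_one_self[of x] by linarith
    then have "exp (- x) \<le> 1 / x"
      using x by (simp add: exp_minus field_simps)
    then have "real M * (real k * exp (- x)) \<le> real M * (real k * (1 / x))"
      by (intro mult_left_mono) auto
    then show ?thesis by (simp add: x_def mult_ac)
  qed
  ultimately show ?thesis by linarith
qed

text \<open>Stage \<open>i\<close>, counted from 0, starts from \<open>2 ^ i * K\<close> vertices,
  so its error is \<open>2 ^ i\<close> times smaller than the first one;
  \<open>2 - 2 / 2 ^ r\<close> is the geometric sum.\<close>

lemma fail_cascade:
  assumes f: "wf13 f" "\<And>j. j < r * k \<Longrightarrow> f (h + j) = 3"
    and \<beta>: "0 < \<beta>" "\<beta> \<le> 1" "0 < \<delta>" and K: "K > 0" and \<kappa>: "growth_rate \<beta> \<delta> \<kappa>"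
    and M: "real (M choose k) * \<beta> ^ k \<ge> 2"
    and "cnt h n p \<ge> K" "valid n p"
  shows "fail f n ((grid \<delta> ^^ (r * M)) n) (\<lambda>q. cnt (h + r * k) ((grid \<delta> ^^ (r * M)) n) q \<ge> 2 ^ r * K) p
    \<le> (2 - 2 / 2 ^ r) * (real M * real k / (\<kappa> * \<beta> ^ k * K))"
  using f(2)
proof (induction r)
  case 0
  then show ?case using assms by (simp add: fail_def)
next
  case (Suc r)
  let ?n = "(grid \<delta> ^^ (r * M)) n" and ?b = "real M * real k / (\<kappa> * \<beta> ^ k * K)"
  have e: "(grid \<delta> ^^ (Suc r * M)) n = (grid \<delta> ^^ M) ?n" by (simp add: funpow_add)
  have "fail f n ((grid \<delta> ^^ M) ?n) (\<lambda>q. cnt (h + r * k + k) ((grid \<delta> ^^ M) ?n) q \<ge> 2 * (2 ^ r * K)) p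
      \<le> (2 - 2 / 2 ^ r) * ?b + real M * real k / (\<kappa> * \<beta> ^ k * (2 ^ r * K))"
  proof (rule fail_chain[OF f(1), where I = valid])
    show "fail f n ?n (\<lambda>q. 2 ^ r * K \<le> cnt (h + r * k) ?n q) p \<le> (2 - 2 / 2 ^ r) * ?b"
      by (rule Suc.IH) (rule Suc.prems, simp)
    show "n \<le> ?n" using grid_pow_ge[OF \<beta>(3), of n "r * M"] by simp
    show "?n \<le> (grid \<delta> ^^ M) ?n" using grid_pow_ge[OF \<beta>(3), of ?n M] by simp
    show "valid (Suc i) (p(i := v))" if "valid i p" "v \<le> i" for i p v
      using that by (rule valid_upd)
    show "0 \<le> real M * real k / (\<kappa> * \<beta> ^ k * (2 ^ r * K))"
      using \<beta> K growth_rate_pos[OF \<kappa>] by simp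
    fix q assume q: "valid ?n q" "2 ^ r * K \<le> cnt (h + r * k) ?n q"
    have "f (h + r * k + j) = 3" if "j < k" for j
      using Suc.prems[of "r * k + j"] that by (simp add: add.assoc)
    then show "fail f ?n ((grid \<delta> ^^ M) ?n) (\<lambda>q. cnt (h + r * k + k) ((grid \<delta> ^^ M) ?n) q \<ge> 2 * (2 ^ r * K)) q
        \<le> real M * real k / (\<kappa> * \<beta> ^ k * (2 ^ r * K))"
      using K q by (intro fail_double[OF f(1) _ \<beta> _ \<kappa> M]) auto
  qed fact
  also have "(2 - 2 / 2 ^ r) * ?b + real M * real k / (\<kappa> * \<beta> ^ k * (2 ^ r * K)) = (2 - 2 / 2 ^ Suc r) * ?b"
    using \<beta> K growth_rate_pos[OF \<kappa>] by (simp add: field_simps)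
  finally show ?case unfolding e by (simp add: algebra_simps)
qed

text \<open>The time is fixed before the weight function is given. One level at a time, a single
  vertex at depth \<open>l\<close> suffices: after a long wait there are many at depth
  \<open>l + 1\<close> with high probability.\<close>

lemma fail_cnt_initial:
  assumes "\<epsilon> > 0"
  shows "\<exists>n. \<forall>f. wf13 f \<longrightarrow> fail f 0 n (\<lambda>q. cnt (Suc l) n q \<ge> K) (\<lambda>_. 0) \<le> \<epsilon>"
proof -
  have step: "\<exists>m. \<forall>f. wf13 f \<longrightarrow> fail f 0 m (\<lambda>q. cnt (Suc l) m q \<ge> K) (\<lambda>_. 0) \<le> \<epsilon>"
    if "\<epsilon> > 0" "\<And>f. wf13 f \<Longrightarrow> fail f 0 n (\<lambda>q. cnt l n q \<ge> 1) (\<lambda>_. 0) \<le> \<epsilon> / 2" for \<epsilon> K l n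
  proof (intro exI allI impI)
    fix f assume f: "wf13 f"
    \<comment> \<open>The factor 6 comes from \<open>(1 - exp (- 1)) * f l / 3 \<ge> 1 / 6\<close>,
      the Chernoff bound being applied with \<open>s = 1\<close>.\<close>
    define \<delta> where "\<delta> = max 1 (6 * (K - ln (\<epsilon> / 2)))"
    let ?m = "grid \<delta> n"
    have \<delta>: "\<delta> > 0" by (simp add: \<delta>_def)
    have "fail f 0 ?m (\<lambda>q. cnt (Suc l) ?m q \<ge> K) (\<lambda>_. 0) \<le> \<epsilon> / 2 + \<epsilon> / 2"
    proof (rule fail_chain[OF f, where I = "\<lambda>_ _. True", OF _ _ _ _ that(2)[OF f]])
      show "n \<le> ?m" using grid_gt[OF \<delta>, of n] by simp
      fix q assume q: "cnt l n q \<ge> 1"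
      have "fail f n ?m (\<lambda>q. cnt (Suc l) ?m q \<ge> 0 + K) q
          \<le> exp (1 * K - (1 - exp (- 1)) * (f l / 3 * 1 * \<delta>))"
        using \<delta> grid_gt[OF \<delta>, of n] grid_ln[OF \<delta>] q cnt_nonneg f by (intro fail_cnt_Suc) auto
      also have "1 * K - (1 - exp (- 1)) * (f l / 3 * 1 * \<delta>) \<le> ln (\<epsilon> / 2)"
      proof -
        have "exp (- 1) \<le> (1 / 2 :: real)"
          using exp_ge_add_one_self[of "1 :: real"] by (simp add: exp_minus field_simps)
        then have "1 / 2 * (1 / 3 * \<delta>) \<le> (1 - exp (- 1)) * (f l / 3 * \<delta>)"
          using wf13_ge[OF f, of l] \<delta> by (intro mult_mono mult_right_mono) auto
        moreover have "6 * (K - ln (\<epsilon> / 2)) \<le> \<delta>" by (simp add: \<delta>_def)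
        ultimately show ?thesis by simp
      qed
      also have "exp (ln (\<epsilon> / 2)) = \<epsilon> / 2" using that by simp
      finally show "fail f n ?m (\<lambda>q. cnt (Suc l) ?m q \<ge> K) q \<le> \<epsilon> / 2" by simp
    qed (use that in auto)
    then show "fail f 0 ?m (\<lambda>q. cnt (Suc l) ?m q \<ge> K) (\<lambda>_. 0) \<le> \<epsilon>" by simp
  qed
  have "\<exists>n. \<forall>f. wf13 f \<longrightarrow> fail f 0 n (\<lambda>q. cnt l n q \<ge> 1) (\<lambda>_. 0) \<le> \<epsilon>" if "\<epsilon> > 0" for \<epsilon>
    using that
  proof (induction l arbitrary: \<epsilon>)
    case 0
    have "fail f 0 0 (\<lambda>q. cnt 0 0 q \<ge> 1) (\<lambda>_. 0) \<le> \<epsilon>" for f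
      using 0 by (simp add: fail_def cnt_def dsum_def)
    then show ?case by blast
  next
    case (Suc l)
    obtain n where "\<And>f. wf13 f \<Longrightarrow> fail f 0 n (\<lambda>q. cnt l n q \<ge> 1) (\<lambda>_. 0) \<le> \<epsilon> / 2"
      using Suc.IH[of "\<epsilon> / 2"] Suc.prems by auto
    then show ?case by (rule step[OF Suc.prems])
  qed
  from this[of "\<epsilon> / 2"] obtain n where "\<And>f. wf13 f \<Longrightarrow> fail f 0 n (\<lambda>q. cnt l n q \<ge> 1) (\<lambda>_. 0) \<le> \<epsilon> / 2"
    using assms by auto
  then show ?thesis by (rule step[OF assms])
qed

section \<open>From vertex counts to the height of the tree\<close>

lemma tree_depth_rrt_cong:
  "(\<And>k. k < n \<Longrightarrow> \<omega> k = \<omega>' k) \<Longrightarrow> tree_depth (rrt \<omega> n) = tree_depth (rrt \<omega>' n)"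
  using rrt_cong[of n \<omega> \<omega>'] by simp

lemma tree_depth_ge_cnt:
  assumes "valid n q" "cnt j n q > 0"
  shows "j \<le> tree_depth (rrt q n)"
proof -
  have "\<exists>v\<le>n. dep q v = j"
  proof (rule ccontr)
    assume "\<not> (\<exists>v\<le>n. dep q v = j)"
    then have "cnt j n q = 0" unfolding cnt_def dsum_def by (intro sum.neutral) auto
    then show False using assms by simp
  qed
  then have "j \<in> dep q ` {..n}" by auto
  then show ?thesis unfolding tree_depth_rrt[OF assms(1)] by (intro Max_ge) simp_all
qed

text \<open>The order of quantifiers allows a recursive construction of the weight: \<open>n\<close>
  and \<open>u\<close> work for all weights outside \<open>{l..<u}\<close>. An initial period
  provides \<open>K\<close> vertices at depth \<open>l + 1\<close>, and the cascade then runs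
  through levels of weight 3.\<close>

lemma prob_not_deep_le:
  assumes c: "0 < c" "c < exp 1" and "\<epsilon> > 0"
  shows "\<exists>n\<ge>m. \<exists>u. \<forall>f. wf13 f \<longrightarrow> (\<forall>k\<in>{l..<u}. f k = 3) \<longrightarrow>
    measure (dwrrt_law f) {\<omega>. \<not> real (tree_depth (rrt \<omega> n)) \<ge> c * ln (real n)} \<le> \<epsilon>"
proof -
  obtain M k \<beta> \<delta> where par: "M \<ge> 1" "0 < \<beta>" "\<beta> \<le> 1" "\<beta> < \<delta>" "real (M choose k) * \<beta> ^ k \<ge> 2"
      "real k > c * real M * \<delta>"
    by (rule cascade_parameters[OF c])
  have \<delta>: "\<delta> > 0" using par by simp
  obtain \<kappa> where \<kappa>: "growth_rate \<beta> \<delta> \<kappa>"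
    using growth_rate_exists[OF par(2,4)] by blast
  \<comment> \<open>Large enough for the whole cascade, whose error is at most twice that of its
    first stage, to fail with probability at most \<open>\<epsilon> / 2\<close>.\<close>
  define K where "K = max 1 (4 * real M * real k / (\<kappa> * \<beta> ^ k * \<epsilon>))"
  have K: "K > 0" by (simp add: K_def)
  have Kb: "2 * (real M * real k / (\<kappa> * \<beta> ^ k * K)) \<le> \<epsilon> / 2"
  proof -
    have "4 * real M * real k / (\<kappa> * \<beta> ^ k * \<epsilon>) \<le> K" by (simp add: K_def)
    then show ?thesis using par growth_rate_pos[OF \<kappa>] K \<open>\<epsilon> > 0\<close> by (simp add: field_simps)
  qed
  obtain n0 where n0: "\<And>f. wf13 f \<Longrightarrow> fail f 0 n0 (\<lambda>q. cnt (Suc l) n0 q \<ge> K) (\<lambda>_. 0) \<le> \<epsilon> / 2"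
    using fail_cnt_initial[of "\<epsilon> / 2" K l] \<open>\<epsilon> > 0\<close> by auto
  obtain C where C: "\<And>i. ln (real ((grid \<delta> ^^ i) n0) + 1) \<le> \<delta> * real i + C"
    using ln_grid_pow_le[OF \<delta>] by metis
  \<comment> \<open>\<open>C\<close> accounts for the initial period and the rounding. After
    \<open>r0\<close> stages, the surplus \<open>k - c * M * \<delta>\<close> gained in each stage
    has made up for it.\<close>
  obtain r0 :: nat where r0: "c * C / (real k - c * real M * \<delta>) \<le> real r0"
    using real_arch_simple by blast
  define r where "r = max (Suc m) r0"
  define n where "n = (grid \<delta> ^^ (r * M)) n0"
  have nr: "n \<ge> n0 + r * M" unfolding n_def by (rule grid_pow_ge[OF \<delta>])
  also have "r * M \<ge> Suc m * 1" using par by (intro mult_le_mono) (auto simp: r_def)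
  ultimately have nm: "n \<ge> m" "n \<ge> 1" "n \<ge> n0" by auto
  have rk: "c * ln (real n) \<le> real (r * k)"
  proof -
    have "ln (real n) \<le> ln (real n + 1)" using nm by simp
    also have "\<dots> \<le> \<delta> * real (r * M) + C" unfolding n_def by (rule C)
    finally have "c * ln (real n) \<le> c * (\<delta> * real (r * M) + C)" using c by (intro mult_left_mono) auto
    moreover have "real r * (real k - c * real M * \<delta>) \<ge> c * C"
    proof -
      have "c * C / (real k - c * real M * \<delta>) \<le> real r" using r0 by (simp add: r_def)
      then show ?thesis using par by (simp add: field_simps)
    qed
    ultimately show ?thesis by (simp add: algebra_simps)
  qed
  show ?thesis
  proof (rule exI[of _ n], rule conjI[OF nm(1)], rule exI[of _ "Suc l + r * k"], intro allI impI)
    fix f assume f: "wf13 f" "\<forall>k\<in>{l..<Suc l + r * k}. f k = 3"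
    have "measure (dwrrt_law f) {\<omega>. \<not> real (tree_depth (rrt \<omega> n)) \<ge> c * ln (real n)}
        = fail f 0 n (\<lambda>\<omega>. real (tree_depth (rrt \<omega> n)) \<ge> c * ln (real n)) (\<lambda>_. 0)"
    proof (rule measure_dwrrt_law_fail[OF f(1)])
      show "(c * ln (real n) \<le> real (tree_depth (rrt \<omega> n))) = (c * ln (real n) \<le> real (tree_depth (rrt \<omega>' n)))"
        if "\<And>k. k < n \<Longrightarrow> \<omega> k = \<omega>' k" for \<omega> \<omega>'
        using tree_depth_rrt_cong[of n \<omega> \<omega>'] that by simp
    qed
    also have "\<dots> \<le> fail f 0 n (\<lambda>q. cnt (Suc l + r * k) n q \<ge> 2 ^ r * K) (\<lambda>_. 0)"
    proof (rule fail_mono[OF f(1)])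
      fix q assume q: "valid n q" "2 ^ r * K \<le> cnt (Suc l + r * k) n q"
      have "0 < 2 ^ r * K" using K by simp
      then have "Suc l + r * k \<le> tree_depth (rrt q n)"
        using q by (intro tree_depth_ge_cnt) auto
      then have "r * k \<le> tree_depth (rrt q n)" by simp
      then have "real (r * k) \<le> real (tree_depth (rrt q n))" by (simp only: of_nat_le_iff)
      then show "c * ln (real n) \<le> real (tree_depth (rrt q n))" using rk by linarith
    qed (auto simp: valid_def)
    also have "\<dots> \<le> \<epsilon> / 2 + \<epsilon> / 2"
    proof (rule fail_chain[OF f(1), where I = valid, OF _ _ _ valid_upd n0[OF f(1)]])
      fix q assume q: "valid n0 q" "K \<le> cnt (Suc l) n0 q"
      have "fail f n0 n (\<lambda>q. cnt (Suc l + r * k) n q \<ge> 2 ^ r * K) q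
          \<le> (2 - 2 / 2 ^ r) * (real M * real k / (\<kappa> * \<beta> ^ k * K))"
        unfolding n_def
      proof (rule fail_cascade[OF f(1) _ par(2,3) \<delta> K \<kappa> par(5) q(2,1)])
        show "f (Suc l + j) = 3" if "j < r * k" for j using f(2) that by simp
      qed
      also have "\<dots> \<le> 2 * (real M * real k / (\<kappa> * \<beta> ^ k * K))"
        using par K growth_rate_pos[OF \<kappa>] by (intro mult_right_mono) auto
      also note Kb
      finally show "fail f n0 n (\<lambda>q. cnt (Suc l + r * k) n q \<ge> 2 ^ r * K) q \<le> \<epsilon> / 2" .
    qed (use nm \<open>\<epsilon> > 0\<close> in \<open>simp_all add: valid_def\<close>)
    finally show "measure (dwrrt_law f) {\<omega>. \<not> real (tree_depth (rrt \<omega> n)) \<ge> c * ln (real n)} \<le> \<epsilon>" by simp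
  qed
qed

section \<open>Trees of small height\<close>

lemma cexp_add: "cexp f n j (\<lambda>q. F q + G q) p = cexp f n j F p + cexp f n j G p"
  using cexp_sum[of f n j "\<lambda>b. if b then F else G" "{True, False}" p] by simp

lemma fail_conj:
  assumes "wf13 f"
  shows "fail f n m (\<lambda>q. Q q \<and> R q) p \<le> fail f n m Q p + fail f n m R p"
  unfolding fail_def cexp_add[symmetric]
  by (rule cexp_mono[OF assms, of "\<lambda>_ _. True"]) auto

text \<open>Ville's inequality for a process that is a supermartingale as long as it stays below 1 and
  \<open>ok\<close> holds.\<close>

lemma fail_maximal:
  assumes f: "wf13 f" and "n \<le> m"
    and Y0: "\<And>t q. Y t q \<ge> 0"
    and Y_upd: "\<And>s t q v. s \<le> t \<Longrightarrow> v \<le> t \<Longrightarrow> Y s (q(t := v)) = Y s q"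
    and ok_upd: "\<And>s t q v. s \<le> t \<Longrightarrow> v \<le> t \<Longrightarrow> ok s (q(t := v)) = ok s q"
    and step: "\<And>t q. n \<le> t \<Longrightarrow> t < m \<Longrightarrow> ok t q \<Longrightarrow> Y t q \<le> 1 \<Longrightarrow> step f t (Y (Suc t)) q \<le> Y t q"
  shows "fail f n m (\<lambda>q. (\<forall>s\<in>{n..m}. ok s q) \<longrightarrow> (\<forall>s\<in>{n..m}. Y s q \<le> 1)) p \<le> Y n p"
proof -
  \<comment> \<open>Killed at 0 once \<open>ok\<close> fails, otherwise stopped at 1 once
    \<open>Y\<close> exceeds 1; the supermartingale step of \<open>Y\<close> is invoked only before
    both times.\<close>
  define G where "G t q = (if \<exists>s\<in>{n..t}. \<not> ok s q then 0 else if \<exists>s\<in>{n..t}. Y s q > 1 then 1 else Y t q)" for t q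
  have G0: "G t q \<ge> 0" for t q by (simp add: G_def Y0)
  have "fail f n m (\<lambda>q. (\<forall>s\<in>{n..m}. ok s q) \<longrightarrow> (\<forall>s\<in>{n..m}. Y s q \<le> 1)) p
      \<le> cexp f n (m - n) (G (n + (m - n))) p"
    unfolding fail_def
  proof (rule cexp_mono[OF f, of "\<lambda>_ _. True"])
    fix q
    show "of_bool (\<not> ((\<forall>s\<in>{n..m}. ok s q) \<longrightarrow> (\<forall>s\<in>{n..m}. Y s q \<le> 1))) \<le> G (n + (m - n)) q"
    proof (cases "(\<forall>s\<in>{n..m}. ok s q) \<and> (\<exists>s\<in>{n..m}. Y s q > 1)")
      case True
      then have "G m q = 1" unfolding G_def by auto
      then show ?thesis using \<open>n \<le> m\<close> by simp
    next
      case False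
      then have "(\<forall>s\<in>{n..m}. ok s q) \<longrightarrow> (\<forall>s\<in>{n..m}. Y s q \<le> 1)" by (meson not_le)
      then show ?thesis using G0 by simp
    qed
  qed simp_all
  also have "\<dots> \<le> G n p"
  proof (rule cexp_supermartingale[OF f, of "\<lambda>_ _. True"])
    fix t q assume t: "n \<le> t" "t < n + (m - n)"
    have ex: "(\<exists>s\<in>{n..Suc t}. P s) \<longleftrightarrow> (\<exists>s\<in>{n..t}. P s) \<or> P (Suc t)" for P
      using t by (auto simp: le_Suc_eq)
    show "step f t (G (Suc t)) q \<le> G t q"
    proof (cases "\<exists>s\<in>{n..t}. \<not> ok s q")
      case True
      have "step f t (G (Suc t)) q \<le> step f t (\<lambda>_. 0) q"
      proof (rule step_mono[OF f])
        fix v assume "v \<le> t"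
        then have "\<exists>s\<in>{n..Suc t}. \<not> ok s (q(t := v))" unfolding ex using True ok_upd by auto
        then show "G (Suc t) (q(t := v)) \<le> 0" by (simp add: G_def)
      qed
      then show ?thesis using True by (simp add: step_const[OF f] G_def)
    next
      case ok: False
      show ?thesis
      proof (cases "\<exists>s\<in>{n..t}. Y s q > 1")
        case True
        have "step f t (G (Suc t)) q \<le> step f t (\<lambda>_. 1) q"
        proof (rule step_mono[OF f])
          fix v assume "v \<le> t"
          then have "\<exists>s\<in>{n..Suc t}. Y s (q(t := v)) > 1" unfolding ex using True Y_upd by auto
          then show "G (Suc t) (q(t := v)) \<le> 1" by (simp add: G_def)
        qed
        then show ?thesis using True ok by (simp add: step_const[OF f] G_def)
      next
        case False
        have "step f t (G (Suc t)) q \<le> step f t (Y (Suc t)) q"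
        proof (rule step_mono[OF f])
          fix v assume "v \<le> t"
          then have "\<not> (\<exists>s\<in>{n..t}. Y s (q(t := v)) > 1)" using False Y_upd by auto
          then show "G (Suc t) (q(t := v)) \<le> Y (Suc t) (q(t := v))"
            unfolding G_def ex using Y0[of "Suc t" "q(t := v)"] by (simp del: fun_upd_apply)
        qed
        also have "\<dots> \<le> Y t q"
        proof (rule step)
          have "t \<in> {n..t}" using t by simp
          then show "ok t q" "Y t q \<le> 1" using ok False by (meson not_le)+
        qed (use t in auto)
        also have "Y t q = G t q" using ok False by (simp add: G_def)
        finally show ?thesis .
      qed
    qed
  qed simp_all
  also have "G n p \<le> Y n p" using Y0[of n p] by (simp add: G_def)
  finally show ?thesis .
qed

text \<open>A child of a vertex at depth \<open>k\<close> contributes \<open>g (k + 1)\<close> and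
  arises with weight \<open>f k\<close>, so the condition on \<open>g\<close> bounds the expected
  relative growth. Depths up to \<open>t\<close> suffice, as the tree has \<open>t + 1\<close>
  vertices.\<close>

lemma step_dsum_le:
  assumes f: "wf13 f" and g: "\<And>k. k \<le> t \<Longrightarrow> f k * g (Suc k) \<le> A * g k"
  shows "step f t (dsum g (Suc t)) q \<le> dsum g t q * (1 + A / dsum f t q)"
proof -
  have W: "dsum f t q > 0" by (rule dsum_wf13_pos[OF f])
  have "step f t (dsum g (Suc t)) q
      = (\<Sum>v\<le>t. f (dep q v) / dsum f t q * (dsum g t q + g (Suc (dep q v))))"
    unfolding step_def by (intro sum.cong) (auto simp: dsum_upd simp del: fun_upd_apply)
  also have "\<dots> = dsum g t q * (\<Sum>v\<le>t. f (dep q v) / dsum f t q)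
      + (\<Sum>v\<le>t. f (dep q v) * g (Suc (dep q v)) / dsum f t q)"
    unfolding sum_distrib_left sum.distrib[symmetric]
    by (intro sum.cong) (auto simp: field_simps add_divide_distrib)
  also have "\<dots> \<le> dsum g t q * 1 + (\<Sum>v\<le>t. A * g (dep q v) / dsum f t q)"
    unfolding sum_step_weights[OF f] using W dep_le[of q] order.trans[OF dep_le]
    by (intro add_left_mono sum_mono divide_right_mono g) auto
  also have "\<dots> = dsum g t q * (1 + A / dsum f t q)"
    by (simp add: dsum_def[of g] algebra_simps sum_distrib_left sum_divide_distrib sum.distrib)
  finally show ?thesis .
qed

lemma step_divide: "step f t (\<lambda>q. F q / c) q = step f t F q / c"
  unfolding step_def sum_divide_distrib by (intro sum.cong) auto

lemma dsum_nonneg: "(\<And>k. g k \<ge> 0) \<Longrightarrow> dsum g t q \<ge> 0"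
  unfolding dsum_def by (rule sum_nonneg)

lemma dsum_fun_upd: "s \<le> t \<Longrightarrow> dsum g s (q(t := v)) = dsum g s q"
  unfolding dsum_def by (intro sum.cong) (auto simp del: fun_upd_apply)

text \<open>Shallow vertices are rare, whatever the weights. Here \<open>step_dsum_le\<close> holds
  with \<open>A = 3 / 9\<close>, and the total weight is at least \<open>t + 1\<close>, so the mean
  grows at most like the cube root of time; dividing by the square root gives a
  supermartingale.\<close>

lemma fail_shallow_sum:
  assumes f: "wf13 f" and "c > 0"
  shows "fail f 0 n (\<lambda>q. \<forall>s\<le>n. dsum (\<lambda>k. (1 / 9) ^ k) s q \<le> c * sqrt (real s + 1)) (\<lambda>_. 0) \<le> 1 / c"
proof -
  define g :: "nat \<Rightarrow> real" where "g k = (1 / 9) ^ k" for k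
  define Y where "Y t q = dsum g t q / (c * sqrt (real t + 1))" for t q
  have pos: "c * sqrt (real t + 1) > 0" for t using assms by simp
  have g0: "g k \<ge> 0" for k by (simp add: g_def)
  have "fail f 0 n (\<lambda>q. (\<forall>s\<in>{0..n}. True) \<longrightarrow> (\<forall>s\<in>{0..n}. Y s q \<le> 1)) (\<lambda>_. 0) \<le> Y 0 (\<lambda>_. 0)"
  proof (rule fail_maximal[OF f])
    show "Y t q \<ge> 0" for t q
      unfolding Y_def using pos[of t] by (intro divide_nonneg_pos dsum_nonneg g0)
    fix t q
    let ?x = "1 / (real t + 1)"
    have "step f t (dsum g (Suc t)) q \<le> dsum g t q * (1 + 1 / 3 / dsum f t q)"
      by (rule step_dsum_le[OF f]) (auto simp: g_def wf13_le[OF f])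
    also have "\<dots> \<le> dsum g t q * (1 + 1 / 3 * ?x)"
      using dsum_wf13_ge[OF f, of t q] by (intro mult_left_mono add_left_mono dsum_nonneg g0) (auto simp: field_simps)
    also have "1 + 1 / 3 * ?x \<le> sqrt (1 + ?x)"
    proof (rule real_le_rsqrt)
      have "(1 + 1 / 3 * x)\<^sup>2 \<le> 1 + x" if "0 \<le> x" "x \<le> 1" for x :: real
        using mult_left_mono[OF that(2,1)] that by (simp add: power2_eq_square algebra_simps)
      from this[of ?x] show "(1 + 1 / 3 * ?x)\<^sup>2 \<le> 1 + ?x" by (simp only: divide_nonneg_pos) simp
    qed
    also have "sqrt (1 + ?x) = sqrt (real (Suc t) + 1) / sqrt (real t + 1)"
      unfolding real_sqrt_divide[symmetric] by (simp add: field_simps)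
    finally have "step f t (dsum g (Suc t)) q \<le> dsum g t q * (sqrt (real (Suc t) + 1) / sqrt (real t + 1))"
      using dsum_nonneg[OF g0] by (simp add: mult_left_mono)
    then show "step f t (Y (Suc t)) q \<le> Y t q"
      unfolding Y_def step_divide using assms by (simp add: field_simps)
  qed (auto simp: Y_def dsum_fun_upd simp del: fun_upd_apply)
  also have "Y 0 (\<lambda>_. 0) = 1 / c" by (simp add: Y_def dsum_def g_def)
  also have "(\<lambda>q. (\<forall>s\<in>{0..n}. True) \<longrightarrow> (\<forall>s\<in>{0..n}. Y s q \<le> 1)) =
      (\<lambda>q. \<forall>s\<le>n. dsum (\<lambda>k. (1 / 9) ^ k) s q \<le> c * sqrt (real s + 1))"
  proof -
    have "Y s q \<le> 1 \<longleftrightarrow> dsum g s q \<le> c * sqrt (real s + 1)" for s q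
      using pos[of s] unfolding Y_def by (subst pos_divide_le_eq) auto
    moreover have "g = (\<lambda>k. (1 / 9) ^ k)" by (simp add: g_def[abs_def])
    ultimately show ?thesis by auto
  qed
  finally show ?thesis .
qed

text \<open>Beyond depth \<open>L\<close> the growth by \<open>e\<^sup>2\<close> per level, instead of \<open>e\<close>, is compensated by the weight 1,
  instead of 3, since \<open>e \<le> 3\<close>.\<close>

definition height_weight :: "nat \<Rightarrow> nat \<Rightarrow> real" where
  "height_weight L k = exp (real (k + (k - L)))"

text \<open>A vertex can fall short of weight 3, by 2, only at depths below \<open>l\<close> or from
  \<open>L\<close> on. There \<open>9 ^ l * (1 / 9) ^ k\<close> or
  \<open>exp (- L) * height_weight L k\<close>, respectively, is at least 1. The two losses are at
  most \<open>(t + 1) / 30\<close> and \<open>2 * (t + 1) / 30\<close>.\<close>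

lemma weight_ge:
  assumes f: "wf13 f" and "\<forall>k\<in>{l..<L}. f k = 3"
    and "dsum (\<lambda>k. (1 / 9) ^ k) t q \<le> c * sqrt (real t + 1)" "60 * 9 ^ l * c \<le> sqrt (real t + 1)"
    and "exp (- real L) * dsum (height_weight L) t q \<le> (real t + 1) / 30"
  shows "dsum f t q \<ge> 2.9 * (real t + 1)"
proof -
  have pw: "3 - 2 * 9 ^ l * (1 / 9) ^ k - 2 * (exp (- real L) * height_weight L k) \<le> f k" for k
  proof -
    have p0: "(1 / 9 :: real) ^ k \<ge> 0" "exp (- real L) * height_weight L k \<ge> 0" by (simp_all add: height_weight_def)
    consider "k < l" | "l \<le> k" "k < L" | "L \<le> k" by linarith
    then show ?thesis
    proof cases
      case 1
      then have "(9 :: real) ^ l * (1 / 9) ^ k = 9 ^ (l - k)"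
        by (simp add: power_diff power_divide)
      also have "\<dots> \<ge> 1" by simp
      finally show ?thesis using wf13_ge[OF f, of k] p0 by simp
    next
      case 2
      then have "f k = 3" using assms(2) by simp
      moreover have "2 * (9 :: real) ^ l * (1 / 9) ^ k \<ge> 0" by simp
      ultimately show ?thesis using p0 by linarith
    next
      case 3
      then have "exp (- real L) * height_weight L k \<ge> 1" by (simp add: height_weight_def flip: exp_add)
      moreover have "2 * (9 :: real) ^ l * (1 / 9) ^ k \<ge> 0" by simp
      ultimately show ?thesis using wf13_ge[OF f, of k] by linarith
    qed
  qed
  have "3 * (real t + 1) - 2 * 9 ^ l * dsum (\<lambda>k. (1 / 9) ^ k) t q - 2 * (exp (- real L) * dsum (height_weight L) t q)
      = (\<Sum>v\<le>t. 3 - 2 * 9 ^ l * (1 / 9) ^ dep q v - 2 * (exp (- real L) * height_weight L (dep q v)))"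
    by (simp add: dsum_def sum_subtractf sum_distrib_left)
  also have "\<dots> \<le> dsum f t q"
    unfolding dsum_def by (intro sum_mono pw)
  finally have *: "3 * (real t + 1) - 2 * 9 ^ l * dsum (\<lambda>k. (1 / 9) ^ k) t q
      - 2 * (exp (- real L) * dsum (height_weight L) t q) \<le> dsum f t q" .
  have "60 * 9 ^ l * dsum (\<lambda>k. (1 / 9) ^ k) t q \<le> 60 * 9 ^ l * (c * sqrt (real t + 1))"
    using assms by (intro mult_left_mono) auto
  also have "\<dots> = 60 * 9 ^ l * c * sqrt (real t + 1)" by simp
  also have "\<dots> \<le> sqrt (real t + 1) * sqrt (real t + 1)"
    using assms by (intro mult_right_mono) auto
  also have "\<dots> = real t + 1" by simp
  finally show ?thesis using * assms by simp
qed

text \<open>The exponent 2.9 leaves room above 2.82 for second-order terms, and 2.82 exceeds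
  \<open>3 * exp 1 / 2.9\<close>, the growth rate met in \<open>fail_height_sum\<close>.\<close>

lemma one_plus_le_powr:
  fixes x :: real
  assumes "0 \<le> x" "x \<le> 1 / 100"
  shows "1 + 2.82 * x \<le> (1 + x) powr 2.9"
proof -
  have "ln (1 / (1 + x)) \<le> 1 / (1 + x) - 1" using assms by (intro ln_le_minus_one) auto
  then have "x / (1 + x) \<le> ln (1 + x)" using assms by (simp add: ln_div field_simps)
  moreover have "2.82 * x \<le> 2.9 * (x / (1 + x))"
  proof -
    have "2.82 * x * x \<le> 2.82 * x * (1 / 100)" using assms by (intro mult_left_mono) auto
    then have "2.82 * x * (1 + x) \<le> 2.9 * x" using assms by (simp add: algebra_simps)
    then show ?thesis using assms by (simp add: field_simps)
  qed
  ultimately have "2.82 * x \<le> 2.9 * ln (1 + x)" by linarith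
  then have "exp (2.82 * x) \<le> (1 + x) powr 2.9" using assms by (simp add: powr_def)
  then show ?thesis using exp_ge_add_one_self[of "2.82 * x"] by linarith
qed

text \<open>A bootstrap, hence the use of Ville's inequality: while the sum normalised by
  \<open>C * (t + 1) powr 2.9\<close> is at most 1, few vertices lie at depth \<open>L\<close> or
  more, so \<open>weight_ge\<close> gives total weight at least \<open>2.9 * (t + 1)\<close>, and
  this makes the normalised sum a supermartingale.\<close>

lemma fail_height_sum:
  assumes f: "wf13 f" and f3: "\<forall>k\<in>{l..<L}. f k = 3" and f1: "\<forall>k\<in>{L..n}. f k = 1"
    and t0: "100 \<le> t0" "t0 \<le> n" "valid t0 p" "60 * 9 ^ l * c \<le> sqrt (real t0 + 1)"
    and C: "C > 0" "\<And>t. t \<le> n \<Longrightarrow> exp (- real L) * (C * (real t + 1) powr 2.9) \<le> (real t + 1) / 30"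
  shows "fail f t0 n (\<lambda>q. (\<forall>s\<in>{t0..n}. dsum (\<lambda>k. (1 / 9) ^ k) s q \<le> c * sqrt (real s + 1)) \<longrightarrow>
      dsum (height_weight L) n q \<le> C * (real n + 1) powr 2.9) p \<le> dsum (height_weight L) t0 p / C"
proof -
  define Y where "Y t q = dsum (height_weight L) t q / (C * (real t + 1) powr 2.9)" for t q
  have pos: "C * (real t + 1) powr 2.9 > 0" for t using C by simp
  have hw0: "height_weight L k \<ge> 0" for k by (simp add: height_weight_def)
  let ?ok = "\<lambda>s q. dsum (\<lambda>k. (1 / 9) ^ k) s q \<le> c * sqrt (real s + 1)"
  have "fail f t0 n (\<lambda>q. (\<forall>s\<in>{t0..n}. ?ok s q) \<longrightarrow> dsum (height_weight L) n q \<le> C * (real n + 1) powr 2.9) p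
      \<le> fail f t0 n (\<lambda>q. (\<forall>s\<in>{t0..n}. ?ok s q) \<longrightarrow> (\<forall>s\<in>{t0..n}. Y s q \<le> 1)) p"
  proof (rule fail_mono[OF f t0(2,3)], rule impI)
    fix q assume "(\<forall>s\<in>{t0..n}. ?ok s q) \<longrightarrow> (\<forall>s\<in>{t0..n}. Y s q \<le> 1)" "\<forall>s\<in>{t0..n}. ?ok s q"
    then have "Y n q \<le> 1" using t0 by auto
    then show "dsum (height_weight L) n q \<le> C * (real n + 1) powr 2.9"
      using pos[of n] C by (simp add: Y_def divide_le_eq_1)
  qed
  also have "\<dots> \<le> Y t0 p"
  proof (rule fail_maximal[OF f t0(2)])
    show "Y t q \<ge> 0" for t q
      unfolding Y_def using pos[of t] by (intro divide_nonneg_pos dsum_nonneg hw0)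
    fix t q
    assume t: "t0 \<le> t" "t < n" and ok: "?ok t q" and Y: "Y t q \<le> 1"
    let ?x = "1 / (real t + 1)"
    have x: "0 \<le> ?x" "?x \<le> 1 / 100" using t t0 by (auto simp: field_simps)
    have "dsum (height_weight L) t q \<le> C * (real t + 1) powr 2.9"
      using Y pos[of t] C by (simp add: Y_def divide_le_eq_1)
    then have "exp (- real L) * dsum (height_weight L) t q \<le> exp (- real L) * (C * (real t + 1) powr 2.9)"
      by (intro mult_left_mono) auto
    also have "\<dots> \<le> (real t + 1) / 30" using t by (intro C) simp
    finally have S: "exp (- real L) * dsum (height_weight L) t q \<le> (real t + 1) / 30" .
    have "60 * 9 ^ l * c \<le> sqrt (real t + 1)"
      using t by (intro order.trans[OF t0(4)]) simp
    from weight_ge[OF f f3 ok this S] have W: "2.9 * (real t + 1) \<le> dsum f t q" .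
    have "step f t (dsum (height_weight L) (Suc t)) q \<le> dsum (height_weight L) t q * (1 + 3 * exp 1 / dsum f t q)"
    proof (rule step_dsum_le[OF f])
      fix k assume k: "k \<le> t"
      show "f k * height_weight L (Suc k) \<le> 3 * exp 1 * height_weight L k"
      proof (cases "k < L")
        case True
        then have "height_weight L (Suc k) = exp 1 * height_weight L k" by (simp add: height_weight_def flip: exp_add)
        then show ?thesis using wf13_le[OF f, of k] hw0[of k] by (simp add: mult_right_mono)
      next
        case False
        then have "height_weight L (Suc k) = exp 1 * exp 1 * height_weight L k"
          by (simp add: height_weight_def Suc_diff_le flip: exp_add)
        moreover have "f k = 1" using False k t f1 by simp
        moreover have "exp 1 * (exp 1 * height_weight L k) \<le> 3 * (exp 1 * height_weight L k)"
          using exp_le hw0[of k] by (intro mult_right_mono) auto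
        ultimately show ?thesis by (simp add: mult_ac)
      qed
    qed
    also have "\<dots> \<le> dsum (height_weight L) t q * (1 + 2.82 * ?x)"
    proof (intro mult_left_mono add_left_mono dsum_nonneg hw0)
      \<comment> \<open>From \<open>exp 1 < 2.72\<close>; moreover
        \<open>8.16 / 2.9 < 2.82\<close>.\<close>
      have "3 * exp 1 / dsum f t q \<le> 8.16 / (2.9 * (real t + 1))"
        using W e_less_272 by (intro frac_le) auto
      also have "\<dots> = 8.16 / 2.9 * ?x" by simp
      also have "\<dots> \<le> 2.82 * ?x" by (intro mult_right_mono) auto
      finally show "3 * exp 1 / dsum f t q \<le> 2.82 * ?x" .
    qed
    also have "\<dots> \<le> dsum (height_weight L) t q * (1 + ?x) powr 2.9"
      using one_plus_le_powr[OF x] by (intro mult_left_mono dsum_nonneg hw0)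
    also have "1 + ?x = (real (Suc t) + 1) / (real t + 1)" by (simp add: field_simps)
    also have "\<dots> powr 2.9 = (real (Suc t) + 1) powr 2.9 / (real t + 1) powr 2.9"
      by (rule powr_divide)
    finally show "step f t (Y (Suc t)) q \<le> Y t q"
      unfolding Y_def step_divide using C by (simp add: field_simps)
  qed (auto simp: Y_def dsum_fun_upd simp del: fun_upd_apply)
  also have "Y t0 p \<le> dsum (height_weight L) t0 p / C"
  proof -
    have "1 powr 2.9 \<le> (real t0 + 1) powr 2.9" by (intro powr_mono2) auto
    then have "C * 1 \<le> C * (real t0 + 1) powr 2.9" using C by (intro mult_left_mono) auto
    then show ?thesis unfolding Y_def using C by (intro divide_left_mono dsum_nonneg hw0) auto
  qed
  finally show ?thesis .
qed

text \<open>With \<open>L\<close> about \<open>2 * ln n\<close>, a vertex at depth \<open>d\<close>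
  above \<open>5 / 2 * ln n\<close> has height weight \<open>exp (2 * d - L)\<close>, of order at
  least \<open>n ^ 3\<close>, while the whole sum is of order at most \<open>n powr 2.9\<close> with
  high probability.\<close>

lemma prob_deep_le:
  assumes "\<epsilon> > 0"
  shows "\<exists>n\<ge>m. \<exists>L\<ge>l. \<forall>f. wf13 f \<longrightarrow> (\<forall>k\<in>{l..<L}. f k = 3) \<longrightarrow> (\<forall>k\<in>{L..n}. f k = 1) \<longrightarrow>
    measure (dwrrt_law f) {\<omega>. \<not> real (tree_depth (rrt \<omega> n)) \<le> 5 / 2 * ln (real n)} \<le> \<epsilon>"
proof -
  define c where "c = 2 / \<epsilon>"
  have c: "c > 0" "1 / c = \<epsilon> / 2" using assms by (simp_all add: c_def)
  \<comment> \<open>The 100 ensures \<open>1 / (t + 1) \<le> 1 / 100\<close> from \<open>t0\<close>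
    on; the square makes the loss from depths below \<open>l\<close> small enough for
    \<open>weight_ge\<close>.\<close>
  define t0 where "t0 = max 100 (nat \<lceil>(60 * 9 ^ l * c)\<^sup>2\<rceil>)"
  have "(60 * 9 ^ l * c)\<^sup>2 \<le> real t0 + 1" unfolding t0_def by linarith
  then have t0: "60 * 9 ^ l * c \<le> sqrt (real t0 + 1)" "t0 \<ge> 100"
    by (auto intro: real_le_rsqrt simp: t0_def)
  \<comment> \<open>At time \<open>t0\<close> all depths are at most \<open>t0\<close>, so the
    height sum is at most \<open>(t0 + 1) * exp (2 * t0)\<close>; division by \<open>C\<close>
    leaves \<open>1 / c = \<epsilon> / 2\<close>.\<close>
  define C where "C = (real t0 + 1) * exp (2 * real t0) * c"
  have C: "C > 0" using c by (simp add: C_def)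
  \<comment> \<open>The first condition keeps the bootstrap consistent up to time \<open>n\<close>,
    the second excludes deep vertices, the third puts \<open>L\<close> above
    \<open>l\<close>.\<close>
  have "eventually (\<lambda>n. 30 * C * (real n + 1) powr 1.9 \<le> real n ^ 2) sequentially"
    using C by real_asymp
  moreover have "eventually (\<lambda>n. C * (real n + 1) powr 2.9 * exp 1 < real n ^ 3) sequentially"
    using C by real_asymp
  moreover have "eventually (\<lambda>n. real l \<le> 2 * ln (real n)) sequentially"
    by real_asymp
  moreover have "eventually (\<lambda>n. n \<ge> max m t0) sequentially" by (rule eventually_ge_at_top)
  ultimately have "eventually (\<lambda>n. 30 * C * (real n + 1) powr 1.9 \<le> real n ^ 2 \<and>
      C * (real n + 1) powr 2.9 * exp 1 < real n ^ 3 \<and> real l \<le> 2 * ln (real n) \<and> n \<ge> max m t0) sequentially"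
    by eventually_elim auto
  then obtain n where n: "30 * C * (real n + 1) powr 1.9 \<le> real n ^ 2"
      "C * (real n + 1) powr 2.9 * exp 1 < real n ^ 3" "real l \<le> 2 * ln (real n)" "n \<ge> m" "n \<ge> t0"
    by (auto simp: eventually_sequentially)
  have n1: "real n \<ge> 1" using n t0 by simp
  define L where "L = nat \<lceil>2 * ln (real n)\<rceil>"
  have L: "2 * ln (real n) \<le> real L" "real L \<le> 2 * ln (real n) + 1" "l \<le> L"
    using n(3) n1 ln_ge_zero[OF n1] unfolding L_def by linarith+
  have C_small: "exp (- real L) * (C * (real t + 1) powr 2.9) \<le> (real t + 1) / 30" if "t \<le> n" for t
  proof -
    have "exp (- real L) \<le> exp (- (2 * ln (real n)))" using L by simp
    also have "\<dots> = 1 / real n ^ 2" using n1 by (simp add: exp_minus exp_double field_simps)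
    finally have "exp (- real L) * (C * (real t + 1) powr 1.9) \<le> 1 / real n ^ 2 * (C * (real n + 1) powr 1.9)"
      using that C by (intro mult_mono mult_left_mono powr_mono2) auto
    also have "\<dots> \<le> 1 / 30" using n(1) n1 by (simp add: field_simps)
    finally have "exp (- real L) * (C * (real t + 1) powr 1.9) * (real t + 1) \<le> 1 / 30 * (real t + 1)"
      by (intro mult_right_mono) auto
    moreover have "(real t + 1) powr 2.9 = (real t + 1) powr 1.9 * (real t + 1)"
      using powr_add[of "real t + 1" "1.9" 1] by simp
    ultimately show ?thesis by (simp add: mult_ac)
  qed
  show ?thesis
  proof (rule exI[of _ n], rule conjI[OF n(4)], rule exI[of _ L], rule conjI[OF L(3)], intro allI impI)
    fix f assume f: "wf13 f" and f3: "\<forall>k\<in>{l..<L}. f k = 3" and f1: "\<forall>k\<in>{L..n}. f k = 1"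
    let ?ok = "\<lambda>s q. dsum (\<lambda>k. (1 / 9) ^ k) s q \<le> c * sqrt (real s + 1)"
    let ?A = "\<lambda>q. \<forall>s\<le>n. ?ok s q"
    let ?B = "\<lambda>q. (\<forall>s\<in>{t0..n}. ?ok s q) \<longrightarrow> dsum (height_weight L) n q \<le> C * (real n + 1) powr 2.9"
    have "measure (dwrrt_law f) {\<omega>. \<not> real (tree_depth (rrt \<omega> n)) \<le> 5 / 2 * ln (real n)}
        = fail f 0 n (\<lambda>\<omega>. real (tree_depth (rrt \<omega> n)) \<le> 5 / 2 * ln (real n)) (\<lambda>_. 0)"
    proof (rule measure_dwrrt_law_fail[OF f(1)])
      show "(real (tree_depth (rrt \<omega> n)) \<le> 5 / 2 * ln (real n)) = (real (tree_depth (rrt \<omega>' n)) \<le> 5 / 2 * ln (real n))"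
        if "\<And>k. k < n \<Longrightarrow> \<omega> k = \<omega>' k" for \<omega> \<omega>'
        using tree_depth_rrt_cong[of n \<omega> \<omega>'] that by simp
    qed
    also have "\<dots> \<le> fail f 0 n (\<lambda>q. ?A q \<and> ?B q) (\<lambda>_. 0)"
    proof (rule fail_mono[OF f(1)])
      fix q assume q: "valid n q" "?A q \<and> ?B q"
      then have S: "dsum (height_weight L) n q \<le> C * (real n + 1) powr 2.9" by simp
      let ?d = "tree_depth (rrt q n)"
      have "?d \<in> dep q ` {..n}" unfolding tree_depth_rrt[OF q(1)] by (intro Max_in) auto
      then obtain v where v: "v \<le> n" "dep q v = ?d" by auto
      have "height_weight L (dep q v) \<le> dsum (height_weight L) n q"
        unfolding dsum_def using v by (intro member_le_sum) (auto simp: height_weight_def)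
      then have "height_weight L ?d \<le> C * (real n + 1) powr 2.9" using S v by simp
      \<comment> \<open>The factor \<open>exp 1\<close> absorbs the rounding in
        \<open>L \<le> 2 * ln n + 1\<close>.\<close>
      then have "height_weight L ?d * exp 1 \<le> C * (real n + 1) powr 2.9 * exp 1" by (intro mult_right_mono) auto
      also have "\<dots> < real n ^ 3" by (rule n(2))
      also have "real n ^ 3 = exp (3 * ln (real n))"
        using n1 exp_of_nat_mult[of 3 "ln (real n)"] by simp
      finally have "real (?d + (?d - L)) + 1 < 3 * ln (real n)" by (simp add: height_weight_def flip: exp_add)
      then show "real ?d \<le> 5 / 2 * ln (real n)" using L by linarith
    qed (auto simp: valid_def)
    also have "\<dots> \<le> fail f 0 n ?A (\<lambda>_. 0) + fail f 0 n ?B (\<lambda>_. 0)" by (rule fail_conj[OF f])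
    also have "fail f 0 n ?A (\<lambda>_. 0) \<le> \<epsilon> / 2"
      using fail_shallow_sum[OF f c(1), of n] c(2) by simp
    also have "fail f 0 n ?B (\<lambda>_. 0) \<le> 0 + \<epsilon> / 2"
    \<comment> \<open>The trivial event at time \<open>t0\<close> merely starts the estimate there,
      from an arbitrary valid sequence.\<close>
    proof (rule fail_chain[OF f, where I = valid and Q = "\<lambda>_. True" and m = t0])
      show "fail f 0 t0 (\<lambda>_. True) (\<lambda>_. 0) \<le> 0"
        unfolding fail_def by (rule cexp_le_const[OF f, of "\<lambda>_ _. True"]) auto
      show "valid (Suc i) (p(i := v))" if "valid i p" "v \<le> i" for i p v
        using that by (rule valid_upd)
      fix q assume q: "valid t0 q"
      have "fail f t0 n ?B q \<le> dsum (height_weight L) t0 q / C"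
        by (rule fail_height_sum[OF f f3 f1 t0(2) n(5) q t0(1) C C_small])
      also have "dsum (height_weight L) t0 q \<le> (\<Sum>v\<le>t0. exp (2 * real t0))"
        unfolding dsum_def
      proof (rule sum_mono)
        fix v assume "v \<in> {..t0}"
        then have "dep q v \<le> t0" using dep_le[of q v] by simp
        then show "height_weight L (dep q v) \<le> exp (2 * real t0)" by (simp add: height_weight_def)
      qed
      also have "\<dots> / C = 1 / c" using c by (simp add: C_def add.commute)
      finally show "fail f t0 n ?B q \<le> \<epsilon> / 2" using C c by (simp add: divide_right_mono)
    qed (use n assms in \<open>simp_all add: valid_def\<close>)
    finally show "measure (dwrrt_law f) {\<omega>. \<not> real (tree_depth (rrt \<omega> n)) \<le> 5 / 2 * ln (real n)} \<le> \<epsilon>" by simp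
  qed
qed

section \<open>The weight function\<close>

text \<open>The failure probabilities are summable and each event depends on finitely many choices,
  so Borel-Cantelli applies.\<close>

lemma AE_eventually_tree_depth:
  assumes f: "wf13 f"
    and "\<And>i. measure (dwrrt_law f) {\<omega>. \<not> R i (tree_depth (rrt \<omega> (n i)))} \<le> (1 / 2) ^ i"
  shows "AE \<omega> in dwrrt_law f. eventually (\<lambda>i. R i (tree_depth (rrt \<omega> (n i)))) sequentially"
proof -
  interpret L: prob_space "dwrrt_law f" by (rule prob_space_dwrrt_law)
  have "AE \<omega> in dwrrt_law f. eventually (\<lambda>i. \<omega> \<in> space (dwrrt_law f) -
      {\<omega>. \<not> R i (tree_depth (rrt \<omega> (n i)))}) sequentially"
  proof (rule borel_cantelli_AE1)
    show "{\<omega>. \<not> R i (tree_depth (rrt \<omega> (n i)))} \<in> L.events" for i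
    proof (rule sets_dwrrt_law_prefix[of "n i"])
      show "(\<not> R i (tree_depth (rrt \<omega> (n i)))) = (\<not> R i (tree_depth (rrt \<omega>' (n i))))"
        if "\<And>k. k < n i \<Longrightarrow> \<omega> k = \<omega>' k" for \<omega> \<omega>'
        using tree_depth_rrt_cong[of "n i" \<omega> \<omega>'] that by simp
    qed
    show "summable (\<lambda>i. L.prob {\<omega>. \<not> R i (tree_depth (rrt \<omega> (n i)))})"
      by (rule summable_comparison_test'[of "\<lambda>i. (1 / 2 :: real) ^ i" 0])
         (auto intro!: summable_geometric assms)
  qed (simp add: L.emeasure_eq_measure)
  then show ?thesis by simp
qed

theorem proposition1p4:
  shows "\<exists>f :: nat \<Rightarrow> real. (\<forall>k. f k \<in> {1, 3}) \<and>
    (AE \<omega> in dwrrt_law f.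
       liminf (\<lambda>n. ereal (real (tree_depth (rrt \<omega> n)) / ln (real n))) \<le> ereal (5 / 2) \<and>
       limsup (\<lambda>n. ereal (real (tree_depth (rrt \<omega> n)) / ln (real n))) \<ge> ereal (exp 1))"
proof -
  \<comment> \<open>Rates increasing to \<open>exp 1\<close>, so that a single sequence of times
    yields \<open>exp 1\<close> itself.\<close>
  define c :: "nat \<Rightarrow> real" where "c i = exp 1 - 1 / (real i + 1)" for i
  have "1 / (real i + 1) \<le> 1" "1 / (real i + 1) > 0" for i by auto
  moreover have "exp 1 > (1 :: real)" by simp
  ultimately have c: "0 < c i" "c i < exp 1" for i
    unfolding c_def by (smt (verit))+
  define deep where "deep l i n u \<longleftrightarrow> n \<ge> i \<and> (\<forall>f. wf13 f \<longrightarrow> (\<forall>k\<in>{l..<u}. f k = 3) \<longrightarrow>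
      measure (dwrrt_law f) {\<omega>. \<not> real (tree_depth (rrt \<omega> n)) \<ge> c i * ln (real n)} \<le> (1 / 2) ^ i)"
    for l i n u :: nat
  define shallow where "shallow l i n L \<longleftrightarrow> n \<ge> i \<and> L \<ge> l \<and> (\<forall>f. wf13 f \<longrightarrow> (\<forall>k\<in>{l..<L}. f k = 3) \<longrightarrow>
      (\<forall>k\<in>{L..n}. f k = 1) \<longrightarrow>
      measure (dwrrt_law f) {\<omega>. \<not> real (tree_depth (rrt \<omega> n)) \<le> 5 / 2 * ln (real n)} \<le> (1 / 2) ^ i)"
    for l i n L :: nat
  have "\<exists>n u. deep l i n u" for l i
    unfolding deep_def using prob_not_deep_le[OF c, of "(1 / 2) ^ i" i l i] by auto
  then obtain nA uA where A: "\<And>l i. deep l i (nA l i) (uA l i)" by metis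
  have "\<exists>n L. shallow l i n L" for l i
    unfolding shallow_def using prob_deep_le[of "(1 / 2) ^ i" i l] by auto
  then obtain nB LB where B: "\<And>l i. shallow l i (nB l i) (LB l i)" by metis
  \<comment> \<open>Stage \<open>i\<close> starts at depth \<open>l\<close>: weight 3 below
    \<open>up i l\<close> secures the deep event, and its continuation up to \<open>b i l\<close> is
    the block of weight 3 for the shallow event.\<close>
  define up where "up i l = max l (uA l i)" for i l
  define b where "b i l = LB (up i l) i" for i l
  \<comment> \<open>The next stage starts beyond the shallow time \<open>nB\<close>, so that weight
    1 holds from the end of the block up to depth \<open>nB\<close>, which no vertex exceeds at that
    time.\<close>
  define ls where "ls = rec_nat 0 (\<lambda>i l. Suc (max (nB (up i l) i) (b i l)))"
  have ls_Suc: "ls (Suc i) = Suc (max (nB (up i (ls i)) i) (b i (ls i)))" for i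
    by (simp add: ls_def)
  have up_b: "ls i \<le> up i (ls i)" "up i (ls i) \<le> b i (ls i)" "b i (ls i) < ls (Suc i)"
      "nB (up i (ls i)) i < ls (Suc i)" for i
    using B[of "up i (ls i)" i] by (auto simp: up_def b_def shallow_def ls_Suc)
  have ls_mono: "ls i \<le> ls j" if "i \<le> j" for i j
  proof (rule lift_Suc_mono_le[OF _ that])
    show "ls i \<le> ls (Suc i)" for i using up_b(1-3)[of i] by linarith
  qed
  define f :: "nat \<Rightarrow> real" where "f k = (if \<exists>i. ls i \<le> k \<and> k < b i (ls i) then 3 else 1)" for k
  have f: "wf13 f" by (simp add: wf13_def f_def)
  have f3: "f k = 3" if "ls i \<le> k" "k < b i (ls i)" for i k
    using that by (auto simp: f_def)
  have f1: "f k = 1" if "b i (ls i) \<le> k" "k < ls (Suc i)" for i k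
  proof -
    have "\<not> (ls j \<le> k \<and> k < b j (ls j))" for j
    proof (cases i j rule: linorder_cases)
      case less
      then have "ls (Suc i) \<le> ls j" by (intro ls_mono) simp
      then show ?thesis using that by simp
    next
      case greater
      then have "ls (Suc j) \<le> ls i" by (intro ls_mono) simp
      then show ?thesis using that up_b[of i] up_b(3)[of j] by simp
    qed (use that in simp)
    then show ?thesis by (simp add: f_def)
  qed
  define n1 where "n1 i = nA (ls i) i" for i
  define n2 where "n2 i = nB (up i (ls i)) i" for i
  have n_ge: "n1 i \<ge> i" "n2 i \<ge> i" for i
    using A[of "ls i" i] B[of "up i (ls i)" i] by (simp_all add: n1_def n2_def deep_def shallow_def)
  have AE1: "AE \<omega> in dwrrt_law f. eventually (\<lambda>i. real (tree_depth (rrt \<omega> (n1 i))) \<ge> c i * ln (real (n1 i))) sequentially"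
  proof (rule AE_eventually_tree_depth[OF f])
    fix i
    have "uA (ls i) i \<le> b i (ls i)" using up_b(2)[of i] by (simp add: up_def)
    then have "\<forall>k\<in>{ls i..<uA (ls i) i}. f k = 3" using f3 by (meson atLeastLessThan_iff less_le_trans)
    then show "measure (dwrrt_law f) {\<omega>. \<not> real (tree_depth (rrt \<omega> (n1 i))) \<ge> c i * ln (real (n1 i))} \<le> (1 / 2) ^ i"
      using A[of "ls i" i] f by (simp add: deep_def n1_def)
  qed
  have AE2: "AE \<omega> in dwrrt_law f. eventually (\<lambda>i. real (tree_depth (rrt \<omega> (n2 i))) \<le> 5 / 2 * ln (real (n2 i))) sequentially"
  proof (rule AE_eventually_tree_depth[OF f])
    fix i
    have "\<forall>k\<in>{up i (ls i)..<b i (ls i)}. f k = 3"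
      using f3 up_b(1) by (meson atLeastLessThan_iff le_trans)
    moreover have "\<forall>k\<in>{b i (ls i)..n2 i}. f k = 1"
      using f1 up_b(4) unfolding n2_def by (meson atLeastAtMost_iff le_less_trans)
    ultimately show "measure (dwrrt_law f) {\<omega>. \<not> real (tree_depth (rrt \<omega> (n2 i))) \<le> 5 / 2 * ln (real (n2 i))} \<le> (1 / 2) ^ i"
      using B[of "up i (ls i)" i] f by (simp add: shallow_def n2_def b_def)
  qed
  have lim: "c \<longlonglongrightarrow> exp 1" unfolding c_def by real_asymp
  have n_lim: "filterlim n1 at_top sequentially" "filterlim n2 at_top sequentially"
    using n_ge by (auto intro!: filterlim_at_top_mono[OF filterlim_ident])
  have "AE \<omega> in dwrrt_law f.
       liminf (\<lambda>n. ereal (real (tree_depth (rrt \<omega> n)) / ln (real n))) \<le> ereal (5 / 2) \<and>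
       limsup (\<lambda>n. ereal (real (tree_depth (rrt \<omega> n)) / ln (real n))) \<ge> ereal (exp 1)"
    using AE1 AE2
  proof eventually_elim
    case (elim \<omega>)
    let ?X = "\<lambda>n. real (tree_depth (rrt \<omega> n)) / ln (real n)"
    \<comment> \<open>From index 2 on the times are at least 2, and the logarithm in the denominator
      is positive.\<close>
    have big: "eventually (\<lambda>i. i \<ge> (2 :: nat)) sequentially" by (rule eventually_ge_at_top)
    have lnp: "ln (real n) > 0" if "n \<ge> i" "i \<ge> 2" for n i :: nat
      using that by (intro ln_gt_zero) linarith
    show ?case
    proof
      show "liminf (\<lambda>n. ereal (?X n)) \<le> ereal (5 / 2)"
      proof (rule ccontr)
        assume "\<not> ?thesis"
        then have "eventually (\<lambda>n. ereal (5 / 2) < ereal (?X n)) sequentially"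
          by (intro less_LiminfD) simp
        then have "eventually (\<lambda>i. ereal (5 / 2) < ereal (?X (n2 i))) sequentially"
          using n_lim(2) by (rule eventually_compose_filterlim)
        then have "eventually (\<lambda>i :: nat. False) sequentially"
          using elim(2) big
        proof eventually_elim
          case (elim i)
          then show ?case using lnp[OF n_ge(2) elim(3)] by (simp add: field_simps)
        qed
        then show False by simp
      qed
      show "limsup (\<lambda>n. ereal (?X n)) \<ge> ereal (exp 1)"
      proof (rule ccontr)
        assume "\<not> ?thesis"
        then have "limsup (\<lambda>n. ereal (?X n)) < ereal (exp 1)" by simp
        then obtain d where d: "limsup (\<lambda>n. ereal (?X n)) < ereal d" "ereal d < ereal (exp 1)"
          using ereal_dense2 by blast
        have "eventually (\<lambda>n. ereal (?X n) < ereal d) sequentially"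
          using d(1) by (rule Limsup_lessD)
        then have "eventually (\<lambda>i. ereal (?X (n1 i)) < ereal d) sequentially"
          using n_lim(1) by (rule eventually_compose_filterlim)
        moreover have "eventually (\<lambda>i. c i > d) sequentially"
          using lim d(2) by (intro order_tendstoD) auto
        ultimately have "eventually (\<lambda>i :: nat. False) sequentially"
          using elim(1) big
        proof eventually_elim
          case (elim i)
          have p: "ln (real (n1 i)) > 0" by (rule lnp[OF n_ge(1) elim(4)])
          have "c i \<le> ?X (n1 i)" using elim(3) p by (simp add: field_simps)
          then show ?case using elim by simp
        qed
        then show False by simp
      qed
    qed
  qed
  moreover have "\<forall>k. f k \<in> {1, 3}" using f by (simp add: wf13_def)
  ultimately show ?thesis by blast
qed

end
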